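(* Suppose that $P_1(a,b,c)P_2(a,b,c)P_3(a,b,c)\neq 0$. Then the number and the geometry of the 1-Weierstrass points of the quartic $C_{a,b,c}$ are given by one of the following: (i) $24$ ordinary flexes, forming six $H$-orbits of $4$ points each, and $0$ hyperflexes; (ii) $16$ ordinary flexes, forming four $H$-orbits of $4$ points each, and $4$ hyperflexes, forming one $H$-orbit of $4$ points; (iii) $8$ ordinary flexes, forming two $H$-orbits of $4$ points each, and $8$ hyperflexes, forming two $H$-orbits of $4$ points each; (iv) $0$ ordinary flexes, and $12$ hyperflexes, forming three $H$-orbits of $4$ points each.
   Context: All curves are over $\mathbb{C}$. For parameters $a,b,c\in\mathbb{C}$ with $(a^2-1)(b^2-1)(c^2-1)(a^2-4)(b^2-4)(c^2-4)(a^2+b^2+c^2-abc-4)\neq 0$, let $C_{a,b,c}\subset\mathbb{P}^2$ be the smooth plane quartic $x^4+y^4+z^4+ax^2y^2+bx^2z^2+cy^2z^2=0$. This condition on the parameters is assumed throughout. Put $P_1(a,b,c)=a^2+b^2-abc$, $P_2(a,b,c)=a^2+c^2-abc$, $P_3(a,b,c)=b^2+c^2-abc$. Let $H\cong C_2\times C_2$ be the group of projective transformations generated by $\sigma=\mathrm{diag}(-1,1,1)$ and $\tau=\mathrm{diag}(1,-1,1)$; it acts on $C_{a,b,c}$, and orbits are taken under this action. The 1-Weierstrass points of a smooth plane quartic $C$ (Weierstrass points with respect to the canonical divisor) are exactly its flexes, i.e. the points $p$ where the tangent line meets $C$ at $p$ with contact order at least $3$. A flex is an ordinary flex if the contact order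 is exactly $3$, and a hyperflex if it is $4$. *)

theory Defs
  imports
    "HOL-Algebra.Group_Action"
    "HOL-Algebra.Elementary_Groups"
    "HOL-Analysis.Analysis"
    "HOL-Computational_Algebra.Polynomial"
begin

text \<open>A point of the complex projective plane is the set of all its homogeneous coordinate vectors.\<close>

definition proj_rel :: "((complex^3) \<times> (complex^3)) set" where
  "proj_rel = {(v, w). v \<noteq> 0 \<and> (\<exists>k. k \<noteq> 0 \<and> w = k *s v)}"

definition proj_plane :: "(complex^3) set set" where
  "proj_plane = (- {0}) // proj_rel"

text \<open>The defining form is polymorphic so that it can also be evaluated at polynomials.\<close>

definition quartic_form :: "'r::comm_ring_1 \<Rightarrow> 'r \<Rightarrow> 'r \<Rightarrow> 'r^3 \<Rightarrow> 'r" where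
  "quartic_form a b c v =
     (v$1)^4 + (v$2)^4 + (v$3)^4
     + a * (v$1)^2 * (v$2)^2 + b * (v$1)^2 * (v$3)^2 + c * (v$2)^2 * (v$3)^2"

definition quartic_curve :: "complex \<Rightarrow> complex \<Rightarrow> complex \<Rightarrow> (complex^3) set set" where
  "quartic_curve a b c = {p \<in> proj_plane. \<forall>v\<in>p. quartic_form a b c v = 0}"

definition quartic_partial ::
    "complex \<Rightarrow> complex \<Rightarrow> complex \<Rightarrow> 3 \<Rightarrow> complex^3 \<Rightarrow> complex" where
  "quartic_partial a b c i v = deriv (\<lambda>s. quartic_form a b c (v + axis i s)) 0"

definition tangent_line ::
    "complex \<Rightarrow> complex \<Rightarrow> complex \<Rightarrow> (complex^3) set \<Rightarrow> (complex^3) set set" where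
  "tangent_line a b c p =
     {q \<in> proj_plane. \<forall>v\<in>p. \<forall>w\<in>q. (\<Sum>i\<in>UNIV. quartic_partial a b c i v * w$i) = 0}"

text \<open>The polynomial in \<open>t\<close> obtained by restricting the quartic form to the parametrized
  line \<open>t \<mapsto> v + t w\<close>.\<close>

definition restrict_to_line ::
    "complex \<Rightarrow> complex \<Rightarrow> complex \<Rightarrow> complex^3 \<Rightarrow> complex^3 \<Rightarrow> complex poly" where
  "restrict_to_line a b c v w = quartic_form [:a:] [:b:] [:c:] (\<chi> i. [:v$i, w$i:])"

text \<open>The intersection multiplicity of the curve with its tangent line at \<open>p\<close>: choose any second
  point \<open>q\<close> of the tangent line, parametrize the line from \<open>p\<close> towards \<open>q\<close> and take the order of
  vanishing at \<open>p\<close>. At a smooth point \<open>p\<close> this does not depend on \<open>q\<close> nor on the homogeneous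
  coordinates, so the description is definite.\<close>

definition contact_order :: "complex \<Rightarrow> complex \<Rightarrow> complex \<Rightarrow> (complex^3) set \<Rightarrow> nat" where
  "contact_order a b c p =
     (THE n. \<exists>q \<in> tangent_line a b c p - {p}. \<exists>v\<in>p. \<exists>w\<in>q.
        n = Polynomial.order 0 (restrict_to_line a b c v w))"

text \<open>For a smooth plane quartic the Weierstrass points of the canonical divisor, which is cut out
  by lines, are the flexes.\<close>

definition weierstrass1_points :: "complex \<Rightarrow> complex \<Rightarrow> complex \<Rightarrow> (complex^3) set set" where
  "weierstrass1_points a b c = {p \<in> quartic_curve a b c. contact_order a b c p \<ge> 3}"

definition ordinary_flexes :: "complex \<Rightarrow> complex \<Rightarrow> complex \<Rightarrow> (complex^3) set set" where
  "ordinary_flexes a b c = {p \<in> quartic_curve a b c. contact_order a b c p = 3}"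

definition hyperflexes :: "complex \<Rightarrow> complex \<Rightarrow> complex \<Rightarrow> (complex^3) set set" where
  "hyperflexes a b c = {p \<in> quartic_curve a b c. contact_order a b c p = 4}"

definition P1 :: "complex \<Rightarrow> complex \<Rightarrow> complex \<Rightarrow> complex" where
  "P1 a b c = a^2 + b^2 - a*b*c"

definition P2 :: "complex \<Rightarrow> complex \<Rightarrow> complex \<Rightarrow> complex" where
  "P2 a b c = a^2 + c^2 - a*b*c"

definition P3 :: "complex \<Rightarrow> complex \<Rightarrow> complex \<Rightarrow> complex" where
  "P3 a b c = b^2 + c^2 - a*b*c"

definition proj_transformation ::
    "complex^3^3 \<Rightarrow> (complex^3) set \<Rightarrow> (complex^3) set" where
  "proj_transformation A = (\<lambda>p\<in>proj_plane. (\<lambda>v. A *v v) ` p)"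

definition diag3 :: "complex \<Rightarrow> complex \<Rightarrow> complex \<Rightarrow> complex^3^3" where
  "diag3 x y z = vector [vector [x, 0, 0], vector [0, y, 0], vector [0, 0, z]]"

definition \<sigma> :: "(complex^3) set \<Rightarrow> (complex^3) set" where
  "\<sigma> = proj_transformation (diag3 (- 1) 1 1)"

definition \<tau> :: "(complex^3) set \<Rightarrow> (complex^3) set" where
  "\<tau> = proj_transformation (diag3 1 (- 1) 1)"

definition H_group :: "((complex^3) set \<Rightarrow> (complex^3) set) monoid" where
  "H_group = subgroup_generated (BijGroup proj_plane) {\<sigma>, \<tau>}"

text \<open>\<open>S\<close> is a disjoint union of exactly \<open>m\<close> orbits of \<open>H_group\<close>, each with \<open>k\<close> points. The first
  conjunct says that the orbits of the points of \<open>S\<close> stay inside \<open>S\<close>.\<close>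

definition forms_H_orbits :: "(complex^3) set set \<Rightarrow> nat \<Rightarrow> nat \<Rightarrow> bool" where
  "forms_H_orbits S m k \<longleftrightarrow>
     \<Union> (orbits H_group S (\<lambda>g. g)) = S \<and>
     finite (orbits H_group S (\<lambda>g. g)) \<and> card (orbits H_group S (\<lambda>g. g)) = m \<and>
     (\<forall>X\<in>orbits H_group S (\<lambda>g. g). finite X \<and> card X = k)"

end

theory Submission
  imports Defs "HOL-Computational_Algebra.Fundamental_Theorem_Algebra"
begin

text \<open>
  The quartic is \<open>Q(x\<^sup>2, y\<^sup>2, z\<^sup>2) = 0\<close> for the quadratic form
  \<open>Q(X, Y, Z) = X\<^sup>2 + Y\<^sup>2 + Z\<^sup>2 + aXY + bXZ + cYZ\<close>, so squaring the coordinates maps it onto the conic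
  \<open>Q = 0\<close>. Away from the coordinate axes the fibres of this map are exactly the \<open>H\<close>-orbits of four
  points, and flexes can be counted on the conic. The conic is rational: choosing a root \<open>r\<close> of
  \<open>r\<^sup>2 + cr + 1\<close>, projection from its point \<open>(0 : r : 1)\<close> parametrizes it by three polynomials \<open>X\<close>,
  \<open>Y\<close>, \<open>Z\<close> of degree at most two.

  The flexes off the axes are the zeros of the Wronskian of \<open>\<surd>X\<close>, \<open>\<surd>Y\<close>, \<open>\<surd>Z\<close>. Up to a nonvanishing
  factor this is the polynomial \<open>W = \<Sum>\<^sub>i L\<^sub>i d\<^sub>i X\<^sub>j X\<^sub>k\<close>, where \<open>X\<^sub>1, X\<^sub>2, X\<^sub>3\<close> are \<open>X, Y, Z\<close>, where
  \<open>L\<^sub>i\<close> is the \<open>i\<close>-th partial derivative of \<open>Q\<close> on the conic, and where \<open>d\<^sub>i\<close> is the discriminant of \<open>X\<^sub>i\<close>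
  as a binary quadratic form. On an axis the contact order is two, because \<open>P1\<close>, \<open>P2\<close>, \<open>P3\<close> are
  nonzero. Together with the nonvanishing of the \<open>d\<^sub>i\<close> this also implies that \<open>W\<close> has degree exactly six
  (the point at infinity of the parametrization lies on an axis) and that no root of \<open>W\<close> lies on an
  axis. Finally the order of \<open>W\<close> at a
  root is the contact order minus two, hence one for ordinary flexes and two for hyperflexes
  (lemmas \<open>contact_orders_on_conic\<close> and \<open>contact_order_param\<close>). So if \<open>m\<close> orbits consist of ordinary
  flexes and \<open>h\<close> orbits of hyperflexes, then \<open>m + 2h = 6\<close>, which leaves the four listed cases.
\<close>

section \<open>Points of the projective plane and sign changes\<close>


definition hpoint :: "complex^3 \<Rightarrow> (complex^3) set" where
  "hpoint v = {k *s v | k. k \<noteq> 0}"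

lemma hpoint_eq_iff: "hpoint v = hpoint w \<longleftrightarrow> (\<exists>k. k \<noteq> 0 \<and> w = k *s v)"
proof
  assume "hpoint v = hpoint w"
  moreover have "w \<in> hpoint w" by (auto simp: hpoint_def intro!: exI[of _ 1])
  ultimately show "\<exists>k. k \<noteq> 0 \<and> w = k *s v" by (auto simp: hpoint_def)
next
  assume "\<exists>k. k \<noteq> 0 \<and> w = k *s v"
  then obtain k where k: "k \<noteq> 0" "w = k *s v" by auto
  have "x *s v \<in> hpoint w" if "x \<noteq> 0" for x
    unfolding hpoint_def using k that by (auto intro!: exI[of _ "x / k"])
  moreover have "x *s w \<in> hpoint v" if "x \<noteq> 0" for x
    unfolding hpoint_def using k that by (auto intro!: exI[of _ "x * k"])
  ultimately show "hpoint v = hpoint w" unfolding hpoint_def[of v] hpoint_def[of w]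
    by (auto simp: hpoint_def)
qed

lemma self_in_hpoint: "v \<in> hpoint v"
  by (auto simp: hpoint_def intro!: exI[of _ 1])

lemma proj_plane_eq: "proj_plane = hpoint ` (- {0})"
proof -
  have "proj_rel `` {v} = hpoint v" if "v \<noteq> 0" for v
    using that by (auto simp: proj_rel_def hpoint_def)
  then show ?thesis unfolding proj_plane_def quotient_def by auto
qed

lemma vec3_exhaust: "\<exists>x y z. v = (vector [x, y, z] :: 'a::zero^3)"
  by (intro exI[of _ "v$1"] exI[of _ "v$2"] exI[of _ "v$3"]) (simp add: vec_eq_iff forall_3)

lemma vec3_eq_iff: "(vector [x, y, z] :: 'a::zero^3) = vector [x', y', z'] \<longleftrightarrow> x = x' \<and> y = y' \<and> z = z'"
  by (simp add: vec_eq_iff forall_3)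

lemma vec3_eq_0_iff: "(vector [x, y, z] :: 'a::zero^3) = 0 \<longleftrightarrow> x = 0 \<and> y = 0 \<and> z = 0"
  by (simp add: vec_eq_iff forall_3)

lemma scale_vec3: "k *s (vector [x, y, z] :: 'a::comm_ring_1^3) = vector [k*x, k*y, k*z]"
  by (simp add: vec_eq_iff forall_3)

text \<open>For \<open>e, f = \<plusminus>1\<close> these are the four elements of \<open>H\<close>.\<close>

definition signs :: "complex \<Rightarrow> complex \<Rightarrow> (complex^3) set \<Rightarrow> (complex^3) set" where
  "signs e f = proj_transformation (diag3 e f 1)"

lemma diag3_mult: "diag3 d e f *v vector [x, y, z] = vector [d*x, e*y, f*z]"
  by (simp add: vec_eq_iff forall_3 diag3_def matrix_vector_mult_def sum_3)

lemma signs_hpoint: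
  assumes "vector [x, y, z] \<noteq> (0 :: complex^3)"
  shows "signs e f (hpoint (vector [x, y, z])) = hpoint (vector [e*x, f*y, z])"
proof -
  have "hpoint (vector [x, y, z]) \<in> proj_plane" using assms by (auto simp: proj_plane_eq)
  moreover have "(\<lambda>v. diag3 e f 1 *v v) ` hpoint (vector [x, y, z]) = hpoint (vector [e*x, f*y, z])"
    by (force simp: hpoint_def scale_vec3 diag3_mult mult.left_commute vec3_eq_iff)
  ultimately show ?thesis by (simp add: signs_def proj_transformation_def)
qed

lemma signs_closed: "e \<noteq> 0 \<Longrightarrow> f \<noteq> 0 \<Longrightarrow> p \<in> proj_plane \<Longrightarrow> signs e f p \<in> proj_plane"
proof -
  assume ef: "e \<noteq> 0" "f \<noteq> 0" and "p \<in> proj_plane"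
  then obtain x y z where p: "p = hpoint (vector [x, y, z])" "vector [x, y, z] \<noteq> (0 :: complex^3)"
    unfolding proj_plane_eq using vec3_exhaust by (metis (no_types, lifting) ComplD imageE insertI1)
  then show "signs e f p \<in> proj_plane" using ef unfolding proj_plane_eq
    by (auto simp: signs_hpoint vec3_eq_0_iff intro!: imageI)
qed

lemma signs_mult:
  assumes "e' \<noteq> 0" "f' \<noteq> 0"
  shows "compose proj_plane (signs e f) (signs e' f') = signs (e*e') (f*f')"
proof
  fix p
  show "compose proj_plane (signs e f) (signs e' f') p = signs (e*e') (f*f') p"
  proof (cases "p \<in> proj_plane")
    case True
    then obtain x y z where p: "p = hpoint (vector [x, y, z])" "vector [x, y, z] \<noteq> (0 :: complex^3)"
      unfolding proj_plane_eq using vec3_exhaust by (metis (no_types, lifting) ComplD imageE insertI1)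
    have "vector [e'*x, f'*y, z] \<noteq> (0 :: complex^3)" using p assms by (auto simp: vec3_eq_0_iff)
    with p True show ?thesis by (simp add: compose_def signs_hpoint mult.assoc)
  next
    case False
    then show ?thesis by (simp add: compose_def signs_def proj_transformation_def)
  qed
qed

lemma signs_1: "signs 1 1 = (\<lambda>p\<in>proj_plane. p)"
proof
  fix p
  show "signs 1 1 p = (\<lambda>p\<in>proj_plane. p) p"
  proof (cases "p \<in> proj_plane")
    case True
    then obtain x y z where p: "p = hpoint (vector [x, y, z])" "vector [x, y, z] \<noteq> (0 :: complex^3)"
      unfolding proj_plane_eq using vec3_exhaust by (metis (no_types, lifting) ComplD imageE insertI1)
    with True show ?thesis by (simp add: signs_hpoint)
  next
    case False
    then show ?thesis by (simp add: signs_def proj_transformation_def)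
  qed
qed

lemma signs_Bij:
  assumes "e \<in> {1, -1}" "f \<in> {1, -1}"
  shows "signs e f \<in> Bij proj_plane"
proof -
  have nz: "e \<noteq> 0" "f \<noteq> 0" and sq: "e * e = 1" "f * f = 1" using assms by auto
  have inv: "signs e f (signs e f p) = p" if "p \<in> proj_plane" for p
    using fun_cong[OF signs_mult[OF nz, of e f], of p] that by (simp add: compose_def sq signs_1)
  have "bij_betw (signs e f) proj_plane proj_plane"
    by (rule bij_betw_byWitness[where f' = "signs e f"]) (use inv signs_closed[OF nz] in auto)
  moreover have "signs e f \<in> extensional proj_plane" by (simp add: signs_def proj_transformation_def)
  ultimately show ?thesis by (simp add: Bij_def)
qed

lemma carrier_H_group:
  "carrier H_group = {signs 1 1, signs (-1) 1, signs 1 (-1), signs (-1) (-1)}" (is "_ = ?K")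
proof -
  let ?G = "BijGroup proj_plane"
  interpret G: group ?G by (rule group_BijGroup)
  have K: "?K = {signs e f | e f. e \<in> {1,-1} \<and> f \<in> {1,-1}}" by auto
  have mult: "signs e f \<otimes>\<^bsub>?G\<^esub> signs e' f' = signs (e*e') (f*f')"
    if "e \<in> {1,-1}" "f \<in> {1,-1}" "e' \<in> {1,-1}" "f' \<in> {1,-1}" for e f e' f'
  proof -
    have "e' \<noteq> 0" "f' \<noteq> 0" using that by auto
    then show ?thesis
      using signs_Bij[of e f] signs_Bij[of e' f'] that signs_mult[of e' f' e f] unfolding BijGroup_def by auto
  qed
  have car: "signs e f \<in> carrier ?G" if "e \<in> {1,-1}" "f \<in> {1,-1}" for e f
    using signs_Bij[OF that] by (simp add: BijGroup_def)
  have one: "\<one>\<^bsub>?G\<^esub> = signs 1 1" by (simp add: BijGroup_def signs_1)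
  have "subgroup ?K ?G"
  proof (rule G.subgroupI)
    show "?K \<subseteq> carrier ?G" using car by blast
    show "?K \<noteq> {}" by simp
  next
    fix g assume "g \<in> ?K"
    then obtain e f where ef: "e \<in> {1,-1}" "f \<in> {1,-1}" "g = signs e f" unfolding K by blast
    then have "g \<otimes>\<^bsub>?G\<^esub> g = \<one>\<^bsub>?G\<^esub>" using mult[of e f e f] one by auto
    then have "inv\<^bsub>?G\<^esub> g = g" using car[OF ef(1,2)] ef(3) by (simp add: G.inv_equality)
    then show "inv\<^bsub>?G\<^esub> g \<in> ?K" using \<open>g \<in> ?K\<close> by simp
  next
    fix g h assume "g \<in> ?K" "h \<in> ?K"
    then obtain e f e' f' where ef: "e \<in> {1,-1}" "f \<in> {1,-1}" "g = signs e f"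
       "e' \<in> {1,-1}" "f' \<in> {1,-1}" "h = signs e' f'" unfolding K by blast
    then have "g \<otimes>\<^bsub>?G\<^esub> h = signs (e*e') (f*f')" using mult by blast
    moreover have "e*e' \<in> {1,-1}" "f*f' \<in> {1,-1}" using ef by auto
    ultimately show "g \<otimes>\<^bsub>?G\<^esub> h \<in> ?K" unfolding K by blast
  qed
  have gens: "carrier ?G \<inter> {\<sigma>, \<tau>} = {signs (-1) 1, signs 1 (-1)}"
    using car[of "-1" 1] car[of 1 "-1"] unfolding \<sigma>_def \<tau>_def signs_def[symmetric] by auto
  have "generate ?G {signs (-1) 1, signs 1 (-1)} \<subseteq> ?K"
    by (rule G.generate_subgroup_incl[OF _ \<open>subgroup ?K ?G\<close>]) auto
  moreover have "?K \<subseteq> generate ?G {signs (-1) 1, signs 1 (-1)}"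
  proof -
    have "signs (-1) (-1) = signs (-1) 1 \<otimes>\<^bsub>?G\<^esub> signs 1 (-1)" using mult[of "-1" 1 1 "-1"] by simp
    moreover have "signs (-1) 1 \<otimes>\<^bsub>?G\<^esub> signs 1 (-1) \<in> generate ?G {signs (-1) 1, signs 1 (-1)}"
      by (rule generate.eng; rule generate.incl) simp_all
    ultimately have "signs (-1) (-1) \<in> generate ?G {signs (-1) 1, signs 1 (-1)}"
      by (simp only:)
    moreover have "signs 1 1 \<in> generate ?G {signs (-1) 1, signs 1 (-1)}"
      unfolding one[symmetric] by (rule generate.one)
    moreover have "signs (-1) 1 \<in> generate ?G {signs (-1) 1, signs 1 (-1)}"
      by (rule generate.incl) simp
    moreover have "signs 1 (-1) \<in> generate ?G {signs (-1) 1, signs 1 (-1)}"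
      by (rule generate.incl) simp
    ultimately show ?thesis by (simp only: insert_subset empty_subsetI simp_thms)
  qed
  ultimately show ?thesis
    unfolding H_group_def carrier_subgroup_generated gens by (rule subset_antisym)
qed

lemma orbit_H:
  assumes "vector [x, y, z] \<noteq> (0 :: complex^3)"
  shows "orbit H_group (\<lambda>g. g) (hpoint (vector [x, y, z])) =
    {hpoint (vector [x, y, z]), hpoint (vector [-x, y, z]), hpoint (vector [x, -y, z]), hpoint (vector [-x, -y, z])}"
proof -
  have "orbit H_group (\<lambda>g. g) (hpoint (vector [x, y, z])) = (\<lambda>g. g (hpoint (vector [x, y, z]))) ` carrier H_group"
    unfolding orbit_def by (rule Setcompr_eq_image)
  then show ?thesis unfolding carrier_H_group by (simp add: signs_hpoint[OF assms])
qed

text \<open>The fibre over \<open>(X : Y : Z)\<close> of the map that squares the coordinates. It depends only on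
that point, not on its homogeneous coordinates, because every complex number is a square.\<close>

definition sqrt_points :: "complex \<Rightarrow> complex \<Rightarrow> complex \<Rightarrow> (complex^3) set set" where
  "sqrt_points X Y Z = {hpoint (vector [x, y, z]) | x y z. x^2 = X \<and> y^2 = Y \<and> z^2 = Z}"

lemma sqrt_points_eq:
  assumes "x^2 = X" "y^2 = Y" "z^2 = Z"
  shows "sqrt_points X Y Z =
    {hpoint (vector [x, y, z]), hpoint (vector [-x, y, z]), hpoint (vector [x, -y, z]), hpoint (vector [-x, -y, z])}"
    (is "_ = ?R")
proof -
  have neg: "hpoint (vector [u, v, - w]) = hpoint (vector [-u, -v, w])" for u v w
    unfolding hpoint_eq_iff by (rule exI[of _ "-1"]) (simp add: scale_vec3)
  show ?thesis
  proof
    show "sqrt_points X Y Z \<subseteq> ?R"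
    proof
      fix p assume "p \<in> sqrt_points X Y Z"
      then obtain x' y' z' where p: "p = hpoint (vector [x', y', z'])" "x'^2 = X" "y'^2 = Y" "z'^2 = Z"
        unfolding sqrt_points_def by blast
      then have "x' = x \<or> x' = -x" "y' = y \<or> y' = -y" "z' = z \<or> z' = -z"
        using assms by (auto simp: power2_eq_iff)
      then show "p \<in> ?R" unfolding p(1) by (elim disjE) (simp_all add: neg)
    qed
    show "?R \<subseteq> sqrt_points X Y Z"
    proof -
      have "hpoint (vector [x', y', z]) \<in> sqrt_points X Y Z" if "x'^2 = X" "y'^2 = Y" for x' y'
        unfolding sqrt_points_def using that assms(3) by blast
      then show ?thesis using assms by simp
    qed
  qed
qed

lemma card_sqrt_points:
  assumes "X \<noteq> 0" "Y \<noteq> 0" "Z \<noteq> 0"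
  shows "card (sqrt_points X Y Z) = 4"
proof -
  obtain x y z where r: "x^2 = X" "y^2 = Y" "z^2 = Z"
    by (metis power2_csqrt)
  then have "x \<noteq> 0" "y \<noteq> 0" "z \<noteq> 0" using assms by auto
  then show ?thesis unfolding sqrt_points_eq[OF r]
    by (simp add: hpoint_eq_iff scale_vec3 vec3_eq_iff)
qed

lemma orbit_sqrt_points:
  assumes "Z \<noteq> 0" "p \<in> sqrt_points X Y Z"
  shows "orbit H_group (\<lambda>g. g) p = sqrt_points X Y Z"
proof -
  obtain x y z where p: "p = hpoint (vector [x, y, z])" "x^2 = X" "y^2 = Y" "z^2 = Z"
    using assms(2) unfolding sqrt_points_def by blast
  then have "z \<noteq> 0" using assms by auto
  then have "vector [x, y, z] \<noteq> (0 :: complex^3)" by (simp add: vec3_eq_0_iff)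
  then show ?thesis using p by (simp add: orbit_H sqrt_points_eq)
qed

text \<open>Fibres over distinct points are disjoint, because proportional coordinate vectors have proportional
squares. This turns a count of points on the conic into a count of points and of orbits on the
quartic.\<close>

lemma sqrt_points_family:
  fixes X Y Z :: "'i \<Rightarrow> complex"
  assumes "finite T"
    and nz: "\<And>t. t \<in> T \<Longrightarrow> X t \<noteq> 0 \<and> Y t \<noteq> 0 \<and> Z t \<noteq> 0"
    and inj: "\<And>t u k. t \<in> T \<Longrightarrow> u \<in> T \<Longrightarrow> X u = k * X t \<Longrightarrow> Y u = k * Y t \<Longrightarrow> Z u = k * Z t \<Longrightarrow> t = u"
    and S: "S = (\<Union>t\<in>T. sqrt_points (X t) (Y t) (Z t))"
  shows "card S = 4 * card T" "forms_H_orbits S (card T) 4"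
proof -
  let ?F = "\<lambda>t. sqrt_points (X t) (Y t) (Z t)"
  have card4: "card (?F t) = 4" if "t \<in> T" for t using card_sqrt_points nz that by blast
  have ne: "?F t \<noteq> {}" and fin: "finite (?F t)" if "t \<in> T" for t
    using card4[OF that] by (metis card.empty zero_neq_numeral, metis card.infinite zero_neq_numeral)
  have disj: "t = u" if "t \<in> T" "u \<in> T" and p: "p \<in> ?F t" "p \<in> ?F u" for t u p
  proof -
    obtain x y z where v: "p = hpoint (vector [x, y, z])" "x^2 = X t" "y^2 = Y t" "z^2 = Z t"
      using p(1) unfolding sqrt_points_def by blast
    obtain x' y' z' where w: "p = hpoint (vector [x', y', z'])" "x'^2 = X u" "y'^2 = Y u" "z'^2 = Z u"
      using p(2) unfolding sqrt_points_def by blast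
    have "hpoint (vector [x, y, z]) = hpoint (vector [x', y', z'])" using v(1) w(1) by simp
    then obtain k where "x' = k * x" "y' = k * y" "z' = k * z"
      unfolding hpoint_eq_iff scale_vec3 vec3_eq_iff by blast
    then have "X u = k^2 * X t" "Y u = k^2 * Y t" "Z u = k^2 * Z t"
      unfolding v(2-4)[symmetric] w(2-4)[symmetric] by (simp_all add: power_mult_distrib)
    then show ?thesis by (rule inj[OF that(1,2)])
  qed
  have inj_F: "inj_on ?F T"
  proof (rule inj_onI)
    fix t u assume tu: "t \<in> T" "u \<in> T" "?F t = ?F u"
    obtain p where "p \<in> ?F t" using ne[OF tu(1)] by blast
    then show "t = u" using disj tu by simp
  qed
  have "?F t \<inter> ?F u = {}" if "t \<in> T" "u \<in> T" "t \<noteq> u" for t u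
    using disj[OF that(1,2)] that(3) by auto
  then have "card S = (\<Sum>t\<in>T. card (?F t))" unfolding S
    by (intro card_UN_disjoint) (simp_all add: assms(1) fin)
  then show "card S = 4 * card T" using card4 by simp
  have "orbit H_group (\<lambda>g. g) p = ?F t" if "t \<in> T" "p \<in> ?F t" for t p
    using orbit_sqrt_points that nz by blast
  moreover have "orbits H_group S (\<lambda>g. g) = (\<Union>t\<in>T. (\<lambda>p. orbit H_group (\<lambda>g. g) p) ` ?F t)"
    unfolding orbits_def S by auto
  ultimately have "orbits H_group S (\<lambda>g. g) = (\<Union>t\<in>T. {?F t})"
    using ne by (simp add: image_constant_conv)
  then have "orbits H_group S (\<lambda>g. g) = ?F ` T" by auto
  then show "forms_H_orbits S (card T) 4"
    unfolding forms_H_orbits_def using assms(1) S fin card4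
    by (simp add: card_image[OF inj_F])
qed

section \<open>Contact orders with the tangent line\<close>

text \<open>The kernel of a nonzero linear form on three-space has dimension two. The solution is given by
Cramer's rule for the two coordinates in which \<open>v\<close> and \<open>w\<close> have a nonzero minor.\<close>

lemma plane_spanned:
  fixes g v w u :: "complex^3"
  assumes g: "g \<noteq> 0" and v: "v \<noteq> 0" and w: "\<And>k. w \<noteq> k *s v"
    and "(\<Sum>i\<in>UNIV. g$i * v$i) = 0" "(\<Sum>i\<in>UNIV. g$i * w$i) = 0" "(\<Sum>i\<in>UNIV. g$i * u$i) = 0"
  shows "\<exists>\<alpha> \<beta>. u = \<alpha> *s v + \<beta> *s w"
proof -
  have solve: "\<exists>\<alpha> \<beta>. u1 = \<alpha> * v1 + \<beta> * w1 \<and> u2 = \<alpha> * v2 + \<beta> * w2 \<and> u3 = \<alpha> * v3 + \<beta> * w3"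
    if d: "v1 * w2 - v2 * w1 \<noteq> 0"
      and "g1 \<noteq> 0 \<or> g2 \<noteq> 0 \<or> g3 \<noteq> 0"
      and ev: "g1 * v1 + g2 * v2 + g3 * v3 = 0" and ew: "g1 * w1 + g2 * w2 + g3 * w3 = 0"
      and eu: "g1 * u1 + g2 * u2 + g3 * u3 = 0"
    for g1 g2 g3 v1 v2 v3 w1 w2 w3 u1 u2 u3 :: complex
  proof -
    let ?d = "v1 * w2 - v2 * w1"
    define \<alpha> \<beta> where "\<alpha> = (u1 * w2 - u2 * w1) / ?d" and "\<beta> = (v1 * u2 - v2 * u1) / ?d"
    have "g3 \<noteq> 0"
    proof
      assume "g3 = 0"
      then have "g1 * v1 + g2 * v2 = 0" "g1 * w1 + g2 * w2 = 0" using ev ew by auto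
      then have "g1 * ?d = 0" "g2 * ?d = 0" by algebra+
      then show False using d that(2) \<open>g3 = 0\<close> by auto
    qed
    have ad: "\<alpha> * ?d = u1 * w2 - u2 * w1" "\<beta> * ?d = v1 * u2 - v2 * u1"
      using d by (auto simp: \<alpha>_def \<beta>_def)
    have "(u1 - (\<alpha> * v1 + \<beta> * w1)) * ?d = 0" "(u2 - (\<alpha> * v2 + \<beta> * w2)) * ?d = 0"
      using ad by algebra+
    then have 12: "u1 = \<alpha> * v1 + \<beta> * w1" "u2 = \<alpha> * v2 + \<beta> * w2" using d by auto
    then have "g3 * (u3 - (\<alpha> * v3 + \<beta> * w3)) = 0" using ev ew eu by algebra
    then show ?thesis using 12 \<open>g3 \<noteq> 0\<close> by auto
  qed
  have g': "g$1 \<noteq> 0 \<or> g$2 \<noteq> 0 \<or> g$3 \<noteq> 0" using g by (simp add: vec_eq_iff forall_3)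
  have e: "g$1 * v$1 + g$2 * v$2 + g$3 * v$3 = 0" "g$1 * w$1 + g$2 * w$2 + g$3 * w$3 = 0"
    "g$1 * u$1 + g$2 * u$2 + g$3 * u$3 = 0" using assms by (simp_all add: sum_3)
  have "v$1 * w$2 - v$2 * w$1 \<noteq> 0 \<or> v$2 * w$3 - v$3 * w$2 \<noteq> 0 \<or> v$3 * w$1 - v$1 * w$3 \<noteq> 0"
  proof (rule ccontr)
    assume "\<not> ?thesis"
    then have c: "v$1 * w$2 = v$2 * w$1" "v$2 * w$3 = v$3 * w$2" "v$3 * w$1 = v$1 * w$3" by auto
    obtain i where i: "v$i \<noteq> 0" using v by (auto simp: vec_eq_iff)
    have "w$j * v$i = w$i * v$j" for i j
      using c exhaust_3[of i] exhaust_3[of j] by (elim disjE) (simp_all add: mult.commute)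
    then have "w = (w$i / v$i) *s v" using i by (simp add: vec_eq_iff field_simps)
    then show False using w by blast
  qed
  then show ?thesis
  proof (elim disjE)
    assume "v$1 * w$2 - v$2 * w$1 \<noteq> 0"
    from solve[OF this g' e] show ?thesis by (simp add: vec_eq_iff forall_3)
  next
    assume "v$2 * w$3 - v$3 * w$2 \<noteq> 0"
    from solve[OF this, of "g$2" "g$3" "g$1" "v$1" "w$1" "u$2" "u$3" "u$1"] g' e
    show ?thesis by (fastforce simp: vec_eq_iff forall_3 algebra_simps)
  next
    assume "v$3 * w$1 - v$1 * w$3 \<noteq> 0"
    from solve[OF this, of "g$3" "g$1" "g$2" "v$2" "w$2" "u$3" "u$1" "u$2"] g' e
    show ?thesis by (fastforce simp: vec_eq_iff forall_3 algebra_simps)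
  qed
qed

lemma order_0_eqI:
  fixes p q :: "complex poly"
  assumes "\<And>t. poly p t = t ^ n * poly q t" "poly q 0 \<noteq> 0"
  shows "order 0 p = n"
proof -
  have p: "p = monom 1 n * q"
    unfolding poly_eq_poly_eq_iff[symmetric] by (rule ext) (simp add: assms(1) poly_monom)
  moreover have "q \<noteq> 0" using assms(2) by auto
  moreover have "monom (1::complex) n * q \<noteq> 0" using \<open>q \<noteq> 0\<close> by simp
  moreover have "order 0 q = 0" using assms(2) by (rule order_0I)
  ultimately show ?thesis by (simp add: order_mult order_0_monom)
qed

definition grad :: "complex \<Rightarrow> complex \<Rightarrow> complex \<Rightarrow> complex^3 \<Rightarrow> complex^3" where
  "grad a b c v = vector [2 * v$1 * (2 * (v$1)^2 + a * (v$2)^2 + b * (v$3)^2),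
     2 * v$2 * (a * (v$1)^2 + 2 * (v$2)^2 + c * (v$3)^2),
     2 * v$3 * (b * (v$1)^2 + c * (v$2)^2 + 2 * (v$3)^2)]"

lemma quartic_partial_eq: "quartic_partial a b c i v = grad a b c v $ i"
proof -
  have "((\<lambda>s. quartic_form a b c (v + axis i s)) has_field_derivative grad a b c v $ i) (at 0)"
    using exhaust_3[of i]
    by (elim disjE; simp add: quartic_form_def grad_def axis_def)
       (auto intro!: derivative_eq_intros simp: algebra_simps power2_eq_square power3_eq_cube)
  then show ?thesis unfolding quartic_partial_def by (rule DERIV_imp_deriv)
qed

lemma poly_restrict_to_line:
  "poly (restrict_to_line a b c v w) t = quartic_form a b c (v + t *s w)"
  by (simp add: restrict_to_line_def quartic_form_def algebra_simps)

lemma grad_scale: "grad a b c (k *s v) = k^3 *s grad a b c v"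
  by (simp add: grad_def vec_eq_iff forall_3 algebra_simps power2_eq_square power3_eq_cube)

text \<open>Every second point of the tangent line is represented by \<open>\<alpha> v + \<beta> w\<close> with \<open>\<beta> \<noteq> 0\<close>. Replacing \<open>w\<close> by
such a vector, or rescaling \<open>v\<close>, multiplies the lowest nonzero coefficient of the restricted form by a
nonzero constant and does not change its position, so one convenient \<open>w\<close> determines the contact order.\<close>

lemma contact_order_eqI:
  assumes v: "v \<noteq> 0" and w: "\<And>k. w \<noteq> k *s v"
    and g: "grad a b c v \<noteq> 0"
    and gv: "(\<Sum>i\<in>UNIV. grad a b c v $ i * v $ i) = 0"
    and gw: "(\<Sum>i\<in>UNIV. grad a b c v $ i * w $ i) = 0"
    and F: "\<And>A B. quartic_form a b c (A *s v + B *s w) = A^2 * B^2 * g2 + A * B^3 * g3 + B^4 * g4"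
    and nz: "g2 \<noteq> 0 \<or> g3 \<noteq> 0 \<or> g4 \<noteq> 0"
  shows "contact_order a b c (hpoint v) = (if g2 \<noteq> 0 then 2 else if g3 \<noteq> 0 then 3 else 4)"
    (is "_ = ?n")
proof -
  have ord: "order 0 (restrict_to_line a b c (\<kappa> *s v) (\<alpha> *s v + \<beta> *s w)) = ?n"
    if "\<kappa> \<noteq> 0" "\<beta> \<noteq> 0" for \<kappa> \<alpha> \<beta>
  proof -
    let ?p = "restrict_to_line a b c (\<kappa> *s v) (\<alpha> *s v + \<beta> *s w)"
    have "poly ?p t = quartic_form a b c ((\<kappa> + t * \<alpha>) *s v + (t * \<beta>) *s w)" for t
      unfolding poly_restrict_to_line by (rule arg_cong[of _ _ "quartic_form a b c"])
        (simp add: vec_eq_iff algebra_simps)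
    then have p: "poly ?p t = (\<kappa> + t * \<alpha>)^2 * (t * \<beta>)^2 * g2 + (\<kappa> + t * \<alpha>) * (t * \<beta>)^3 * g3
       + (t * \<beta>)^4 * g4" for t by (simp only: F)
    consider "g2 \<noteq> 0" | "g2 = 0" "g3 \<noteq> 0" | "g2 = 0" "g3 = 0" "g4 \<noteq> 0" using nz by blast
    then show ?thesis
    proof cases
      case 1
      have "order 0 ?p = 2"
        by (rule order_0_eqI[where q = "[:\<kappa>, \<alpha>:]^2 * [:\<beta>^2 * g2:] + [:\<kappa>, \<alpha>:] * [:0, \<beta>^3 * g3:] + [:0, 0, \<beta>^4 * g4:]"])
          (use 1 that in \<open>simp_all add: p algebra_simps power2_eq_square power3_eq_cube power4_eq_xxxx\<close>)
      then show ?thesis using 1 by simp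
    next
      case 2
      have "order 0 ?p = 3"
        by (rule order_0_eqI[where q = "[:\<kappa>, \<alpha>:] * [:\<beta>^3 * g3:] + [:0, \<beta>^4 * g4:]"])
          (use 2 that in \<open>simp_all add: p algebra_simps power2_eq_square power3_eq_cube power4_eq_xxxx\<close>)
      then show ?thesis using 2 by simp
    next
      case 3
      have "order 0 ?p = 4"
        by (rule order_0_eqI[where q = "[:\<beta>^4 * g4:]"])
          (use 3 that in \<open>simp_all add: p algebra_simps\<close>)
      then show ?thesis using 3 by simp
    qed
  qed
  have "w \<noteq> 0" using w[of 0] by auto
  have tangent: "q \<in> tangent_line a b c (hpoint v) \<longleftrightarrow>
      (\<exists>u. u \<noteq> 0 \<and> q = hpoint u \<and> (\<Sum>i\<in>UNIV. grad a b c v $ i * u $ i) = 0)" for q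
  proof -
    have "(\<forall>v'\<in>hpoint v. \<forall>w'\<in>hpoint u. (\<Sum>i\<in>UNIV. quartic_partial a b c i v' * w'$i) = 0)
      \<longleftrightarrow> (\<Sum>i\<in>UNIV. grad a b c v $ i * u $ i) = 0" for u
    proof -
      have "(\<Sum>i\<in>UNIV. quartic_partial a b c i (k *s v) * (l *s u)$i)
         = k^3 * l * (\<Sum>i\<in>UNIV. grad a b c v $ i * u $ i)" for k l
        by (simp add: quartic_partial_eq grad_scale sum_3 algebra_simps)
      then have "(\<forall>v'\<in>hpoint v. \<forall>w'\<in>hpoint u. (\<Sum>i\<in>UNIV. quartic_partial a b c i v' * w'$i) = 0)"
        if "(\<Sum>i\<in>UNIV. grad a b c v $ i * u $ i) = 0"
        using that unfolding hpoint_def by auto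
      moreover have "(\<Sum>i\<in>UNIV. grad a b c v $ i * u $ i) = 0"
        if "\<forall>v'\<in>hpoint v. \<forall>w'\<in>hpoint u. (\<Sum>i\<in>UNIV. quartic_partial a b c i v' * w'$i) = 0"
        using that self_in_hpoint unfolding quartic_partial_eq by blast
      ultimately show ?thesis by blast
    qed
    then show ?thesis unfolding tangent_line_def proj_plane_eq by auto
  qed
  show ?thesis unfolding contact_order_def
  proof (rule the_equality)
    have "hpoint w \<in> tangent_line a b c (hpoint v) - {hpoint v}"
      using \<open>w \<noteq> 0\<close> gw w tangent by (auto simp: hpoint_eq_iff[of v w] dest: sym)
    moreover have "?n = order 0 (restrict_to_line a b c v w)"
      using ord[of 1 1 0] by simp
    ultimately show "\<exists>q\<in>tangent_line a b c (hpoint v) - {hpoint v}. \<exists>v'\<in>hpoint v. \<exists>w'\<in>q.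
        ?n = order 0 (restrict_to_line a b c v' w')"
      using self_in_hpoint by blast
  next
    fix n
    assume "\<exists>q\<in>tangent_line a b c (hpoint v) - {hpoint v}. \<exists>v'\<in>hpoint v. \<exists>w'\<in>q.
        n = order 0 (restrict_to_line a b c v' w')"
    then obtain q v' w' where q: "q \<in> tangent_line a b c (hpoint v)" "q \<noteq> hpoint v"
      "v' \<in> hpoint v" "w' \<in> q" and n: "n = order 0 (restrict_to_line a b c v' w')" by auto
    obtain u where u: "q = hpoint u" "(\<Sum>i\<in>UNIV. grad a b c v $ i * u $ i) = 0" "u \<noteq> 0"
      using q(1) tangent by auto
    obtain \<alpha> \<beta> where ab: "u = \<alpha> *s v + \<beta> *s w"
      using plane_spanned[OF g v w gv gw u(2)] by auto
    have "\<beta> \<noteq> 0"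
    proof
      assume "\<beta> = 0"
      then have "u = \<alpha> *s v" "\<alpha> \<noteq> 0" using ab u(3) by auto
      then have "hpoint v = hpoint u" unfolding hpoint_eq_iff by auto
      then show False using q(2) u(1) by auto
    qed
    obtain k where k: "k \<noteq> 0" "v' = k *s v" using q(3) by (auto simp: hpoint_def)
    obtain l where l: "l \<noteq> 0" "w' = l *s u" using q(4) u(1) by (auto simp: hpoint_def)
    have "w' = (l * \<alpha>) *s v + (l * \<beta>) *s w" unfolding l(2) ab by (simp add: vec_eq_iff algebra_simps)
    then show "n = ?n" unfolding n k(2) using ord[of k "l * \<beta>" "l * \<alpha>"] k(1) l(1) \<open>\<beta> \<noteq> 0\<close> by simp
  qed
qed

text \<open>The local analysis at one point of the conic. The quadratic parametrization near that point is
\<open>V\<^sub>i (1 + 2p\<^sub>i u + q\<^sub>i u\<^sup>2)\<close>, and \<open>L\<close>, \<open>M\<close>, \<open>K\<close> are the gradients of the form \<open>Q\<close> at its three coefficient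
vectors \<open>V\<close>, \<open>pV\<close>, \<open>qV\<close>; the equations \<open>t0\<close> to \<open>t4\<close> say that \<open>Q\<close> vanishes identically on it. Along the
tangent line of the quartic the defining form has the coefficients \<open>L\<cdot>eV\<close>, \<open>g3\<close>, \<open>g4\<close> in degrees two,
three and four, while \<open>D1\<close> and \<open>D2\<close> are, up to one common nonzero factor, the first and second derivative of the Wronskian
\<open>W\<close>.

At a flex \<open>L\<close> annihilates \<open>V\<close>, \<open>pV\<close> and \<open>eV\<close>, so \<open>e = \<alpha> + \<beta>p\<close>. Everything can then be written in terms of
\<open>\<alpha>\<close>, \<open>\<beta>\<close> and \<open>n\<close>: one finds \<open>g3 = 2\<beta>n\<close> and \<open>D1 = 6\<beta>n\<close>, and if \<open>\<beta> = 0\<close> then \<open>g4 = -2\<alpha>n\<close> and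
\<open>D2 = -24\<alpha>n\<close>, where \<open>\<alpha> = e1 \<noteq> 0\<close>.\<close>

lemma contact_orders_on_conic:
  fixes a b c V1 V2 V3 p1 p2 p3 q1 q2 q3 e1 e2 e3
    L1 L2 L3 M1 M2 M3 K1 K2 K3 n g3 g4 D1 D2 :: complex
  assumes L1_def: "L1 = 2*V1 + a*V2 + b*V3" and L2_def: "L2 = a*V1 + 2*V2 + c*V3" and L3_def: "L3 = b*V1 + c*V2 + 2*V3"
    and M1_def: "M1 = 2*(p1*V1) + a*(p2*V2) + b*(p3*V3)" and M2_def: "M2 = a*(p1*V1) + 2*(p2*V2) + c*(p3*V3)"
    and M3_def: "M3 = b*(p1*V1) + c*(p2*V2) + 2*(p3*V3)"
    and K1_def: "K1 = 2*(q1*V1) + a*(q2*V2) + b*(q3*V3)" and K2_def: "K2 = a*(q1*V1) + 2*(q2*V2) + c*(q3*V3)"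
    and K3_def: "K3 = b*(q1*V1) + c*(q2*V2) + 2*(q3*V3)"
    and e1_def: "e1 = p1^2 - q1" and e2_def: "e2 = p2^2 - q2" and e3_def: "e3 = p3^2 - q3"
    and n_def: "n = M1*(p1*V1) + M2*(p2*V2) + M3*(p3*V3)"
  assumes V: "V1 \<noteq> 0" "V2 \<noteq> 0" "V3 \<noteq> 0"
    and t0: "L1*V1 + L2*V2 + L3*V3 = 0"
    and t1: "L1*(p1*V1) + L2*(p2*V2) + L3*(p3*V3) = 0"
    and t2: "L1*(q1*V1) + L2*(q2*V2) + L3*(q3*V3) + 2 * n = 0"
    and t3: "M1*(q1*V1) + M2*(q2*V2) + M3*(q3*V3) = 0"
    and t4: "K1*(q1*V1) + K2*(q2*V2) + K3*(q3*V3) = 0"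
    and n: "n \<noteq> 0" and e1: "e1 \<noteq> 0"
    and g2: "L1*(e1*V1) + L2*(e2*V2) + L3*(e3*V3) = 0"
  assumes g3_def: "g3 = 2 * (M1*(p1^2*V1) + M2*(p2^2*V2) + M3*(p3^2*V3))"
    and g4_def: "g4 = (p1^2*V1)^2 + (p2^2*V2)^2 + (p3^2*V3)^2 + a*(p1^2*V1)*(p2^2*V2)
           + b*(p1^2*V1)*(p3^2*V3) + c*(p2^2*V2)*(p3^2*V3)"
    and D1_def: "D1 = 2*(M1*(e1*V1) + M2*(e2*V2) + M3*(e3*V3))
        + 2*(L1*(e1*V1)*(p2+p3) + L2*(e2*V2)*(p1+p3) + L3*(e3*V3)*(p1+p2))"
    and D2_def: "D2 = 2*(K1*(e1*V1) + K2*(e2*V2) + K3*(e3*V3))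
        + 8*(M1*(e1*V1)*(p2+p3) + M2*(e2*V2)*(p1+p3) + M3*(e3*V3)*(p1+p2))
        + L1*(e1*V1)*(2*q2+2*q3+8*p2*p3) + L2*(e2*V2)*(2*q1+2*q3+8*p1*p3)
        + L3*(e3*V3)*(2*q1+2*q2+8*p1*p2)"
  shows "D1 = 3 * g3" "D1 = 0 \<Longrightarrow> D2 \<noteq> 0 \<and> g4 \<noteq> 0"
proof -
  define g v w u :: "complex^3" where "g = vector [L1, L2, L3]" and "v = vector [V1, V2, V3]"
    and "w = vector [p1*V1, p2*V2, p3*V3]" and "u = vector [e1*V1, e2*V2, e3*V3]"
  have "g \<noteq> 0"
  proof
    assume "g = 0"
    then have "L1 = 0" "L2 = 0" "L3 = 0" by (simp_all add: g_def vec3_eq_0_iff)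
    then show False using t2 n by simp
  qed
  moreover have "v \<noteq> 0" using V by (simp add: v_def vec3_eq_0_iff)
  moreover have "w \<noteq> k *s v" for k
  proof
    assume "w = k *s v"
    then have *: "p1*V1 = k*V1" "p2*V2 = k*V2" "p3*V3 = k*V3"
      by (simp_all add: w_def v_def scale_vec3 vec3_eq_iff)
    have "n = k^2 * (L1*V1 + L2*V2 + L3*V3)"
      unfolding n_def M1_def M2_def M3_def L1_def L2_def L3_def * by algebra
    then show False using n t0 by simp
  qed
  moreover have "(\<Sum>i\<in>UNIV. g$i * v$i) = 0" "(\<Sum>i\<in>UNIV. g$i * w$i) = 0" "(\<Sum>i\<in>UNIV. g$i * u$i) = 0"
    using t0 t1 g2 by (simp_all add: sum_3 g_def v_def w_def u_def)
  ultimately obtain \<alpha> \<beta> where "u = \<alpha> *s v + \<beta> *s w" using plane_spanned by blast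
  then have "e1*V1 = \<alpha>*V1 + \<beta>*(p1*V1)" "e2*V2 = \<alpha>*V2 + \<beta>*(p2*V2)" "e3*V3 = \<alpha>*V3 + \<beta>*(p3*V3)"
    by (simp_all add: u_def v_def w_def vec_eq_iff forall_3)
  then have "V1 * (e1 - (\<alpha> + \<beta>*p1)) = 0" "V2 * (e2 - (\<alpha> + \<beta>*p2)) = 0" "V3 * (e3 - (\<alpha> + \<beta>*p3)) = 0"
    by algebra+
  then have e: "e1 = \<alpha> + \<beta>*p1" "e2 = \<alpha> + \<beta>*p2" "e3 = \<alpha> + \<beta>*p3" using V by auto
  have q: "p1^2 = e1 + q1" "p2^2 = e2 + q2" "p3^2 = e3 + q3" by (simp_all add: e1_def e2_def e3_def)
  have sym: "M1*V1 + M2*V2 + M3*V3 = 0"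
    using t1 unfolding M1_def M2_def M3_def L1_def L2_def L3_def by algebra
  have symK: "K1*V1 + K2*V2 + K3*V3 = L1*(q1*V1) + L2*(q2*V2) + L3*(q3*V3)"
    unfolding K1_def K2_def K3_def L1_def L2_def L3_def by algebra
  have Me: "M1*(e1*V1) + M2*(e2*V2) + M3*(e3*V3) = \<beta> * n"
  proof -
    have "M1*(e1*V1) + M2*(e2*V2) + M3*(e3*V3) = \<alpha> * (M1*V1 + M2*V2 + M3*V3) + \<beta> * n"
      unfolding e n_def by algebra
    then show ?thesis using sym by simp
  qed
  have g3: "g3 = 2 * \<beta> * n"
  proof -
    have "g3 = 2 * ((M1*(e1*V1) + M2*(e2*V2) + M3*(e3*V3)) + (M1*(q1*V1) + M2*(q2*V2) + M3*(q3*V3)))"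
      unfolding g3_def q by algebra
    then show ?thesis using Me t3 by simp
  qed
  have Lp: "L1*(p1^2*V1) + L2*(p2^2*V2) + L3*(p3^2*V3) = - 2 * n"
  proof -
    have "L1*(p1^2*V1) + L2*(p2^2*V2) + L3*(p3^2*V3) = (L1*(e1*V1) + L2*(e2*V2) + L3*(e3*V3))
       + (L1*(q1*V1) + L2*(q2*V2) + L3*(q3*V3))" unfolding q by algebra
    then show ?thesis using g2 t2 by algebra
  qed
  have Lpe: "L1*(e1*V1)*p1 + L2*(e2*V2)*p2 + L3*(e3*V3)*p3 = - 2 * \<beta> * n"
  proof -
    have "L1*(e1*V1)*p1 + L2*(e2*V2)*p2 + L3*(e3*V3)*p3 = \<alpha> * (L1*(p1*V1) + L2*(p2*V2) + L3*(p3*V3))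
      + \<beta> * (L1*(p1^2*V1) + L2*(p2^2*V2) + L3*(p3^2*V3))" unfolding e by algebra
    then show ?thesis using t1 Lp by simp
  qed
  have "D1 = 2*(M1*(e1*V1) + M2*(e2*V2) + M3*(e3*V3))
     + 2*((p1+p2+p3) * (L1*(e1*V1) + L2*(e2*V2) + L3*(e3*V3)) - (L1*(e1*V1)*p1 + L2*(e2*V2)*p2 + L3*(e3*V3)*p3))"
    unfolding D1_def by algebra
  also have "\<dots> = 6 * \<beta> * n" unfolding Me g2 Lpe by simp
  finally have D1: "D1 = 6 * \<beta> * n" .
  then show "D1 = 3 * g3" using g3 by simp
  assume "D1 = 0"
  then have "\<beta> = 0" using D1 n by simp
  then have e': "e1 = \<alpha>" "e2 = \<alpha>" "e3 = \<alpha>" using e by auto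
  then have "\<alpha> \<noteq> 0" using e1 by simp
  have "g4 = \<alpha> * (L1*(q1*V1) + L2*(q2*V2) + L3*(q3*V3))"
  proof -
    have "2 * g4 = \<alpha>^2 * (L1*V1 + L2*V2 + L3*V3) + 2 * \<alpha> * (L1*(q1*V1) + L2*(q2*V2) + L3*(q3*V3))
      + (K1*(q1*V1) + K2*(q2*V2) + K3*(q3*V3))"
      unfolding g4_def q e' L1_def L2_def L3_def K1_def K2_def K3_def by algebra
    then show ?thesis using t0 t4 by simp
  qed
  also have "\<dots> = - 2 * \<alpha> * n" using t2 by algebra
  finally have "g4 \<noteq> 0" using \<open>\<alpha> \<noteq> 0\<close> n by simp
  moreover have "D2 \<noteq> 0"
  proof -
    define s where "s = p1 + p2 + p3"
    have "D2 = \<alpha> * (2*(K1*V1 + K2*V2 + K3*V3)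
        + 8*(s * (M1*V1 + M2*V2 + M3*V3) - n)
        + 2*(q1+q2+q3) * (L1*V1 + L2*V2 + L3*V3) - 2*(L1*(q1*V1) + L2*(q2*V2) + L3*(q3*V3))
        + 8*((p1*p2+p1*p3+p2*p3) * (L1*V1 + L2*V2 + L3*V3) - s * (L1*(p1*V1) + L2*(p2*V2) + L3*(p3*V3))
           + (L1*(p1^2*V1) + L2*(p2^2*V2) + L3*(p3^2*V3))))"
      unfolding D2_def e' s_def n_def by algebra
    also have "\<dots> = - 24 * \<alpha> * n" unfolding symK sym t0 t1 Lp by simp
    finally show ?thesis using \<open>\<alpha> \<noteq> 0\<close> n by simp
  qed
  ultimately show "D2 \<noteq> 0 \<and> g4 \<noteq> 0" by simp
qed

text \<open>The direction \<open>(p\<^sub>1 x, p\<^sub>2 y, p\<^sub>3 z)\<close> is the derivative of \<open>(\<surd>X, \<surd>Y, \<surd>Z)\<close> along the parametrization, so it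
is tangent to the quartic. Expanding with \<open>(A + p\<^sub>i B)\<^sup>2 V\<^sub>i\<close> for the squared coordinates reduces the quartic
form to values of the bilinear form of \<open>Q\<close>.\<close>

lemma quartic_form_line:
  fixes a b c x y z p1 p2 p3 L1 L2 L3 M1 M2 M3 :: complex
  assumes L1_def: "L1 = 2*x^2 + a*y^2 + b*z^2" and L2_def: "L2 = a*x^2 + 2*y^2 + c*z^2" and L3_def: "L3 = b*x^2 + c*y^2 + 2*z^2"
    and M1_def: "M1 = 2*(p1*x^2) + a*(p2*y^2) + b*(p3*z^2)" and M2_def: "M2 = a*(p1*x^2) + 2*(p2*y^2) + c*(p3*z^2)"
    and M3_def: "M3 = b*(p1*x^2) + c*(p2*y^2) + 2*(p3*z^2)"
  assumes t0: "L1*x^2 + L2*y^2 + L3*z^2 = 0"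
    and t1: "L1*(p1*x^2) + L2*(p2*y^2) + L3*(p3*z^2) = 0"
  shows "quartic_form a b c (A *s vector [x,y,z] + B *s vector [p1*x, p2*y, p3*z]) =
     A^2 * B^2 * (L1*(p1^2*x^2) + L2*(p2^2*y^2) + L3*(p3^2*z^2) + 2*(M1*(p1*x^2) + M2*(p2*y^2) + M3*(p3*z^2)))
     + A * B^3 * (2 * (M1*(p1^2*x^2) + M2*(p2^2*y^2) + M3*(p3^2*z^2)))
     + B^4 * ((p1^2*x^2)^2 + (p2^2*y^2)^2 + (p3^2*z^2)^2 + a*(p1^2*x^2)*(p2^2*y^2)
           + b*(p1^2*x^2)*(p3^2*z^2) + c*(p2^2*y^2)*(p3^2*z^2))" (is "?F = ?R")
proof -
  have "2 * quartic_form a b c (A *s vector [x,y,z] + B *s vector [p1*x, p2*y, p3*z]) =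
     A^4 * (L1*x^2 + L2*y^2 + L3*z^2) + 4 * A^3 * B * (L1*(p1*x^2) + L2*(p2*y^2) + L3*(p3*z^2)) +
     2 * (A^2 * B^2 * (L1*(p1^2*x^2) + L2*(p2^2*y^2) + L3*(p3^2*z^2) + 2*(M1*(p1*x^2) + M2*(p2*y^2) + M3*(p3*z^2)))
     + A * B^3 * (2 * (M1*(p1^2*x^2) + M2*(p2^2*y^2) + M3*(p3^2*z^2)))
     + B^4 * ((p1^2*x^2)^2 + (p2^2*y^2)^2 + (p3^2*z^2)^2 + a*(p1^2*x^2)*(p2^2*y^2)
           + b*(p1^2*x^2)*(p3^2*z^2) + c*(p2^2*y^2)*(p3^2*z^2)))"
    unfolding quartic_form_def L1_def L2_def L3_def M1_def M2_def M3_def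
    by (simp add: scale_vec3) algebra
  then have "2 * ?F = 2 * ?R" by (simp only: t0 t1 mult_zero_right add_0_left)
  then show ?thesis by (simp only: mult_cancel_left) simp
qed

text \<open>The local analysis carried over to the quartic: with \<open>V = (x\<^sup>2, y\<^sup>2, z\<^sup>2)\<close> the point \<open>(x, y, z)\<close> lies on it,
\<open>G2\<close> is the coefficient of degree two along the tangent line, and by \<open>D1 = 3 g3\<close> the next coefficient
vanishes at a flex exactly when \<open>D1\<close> does.\<close>

lemma contact_order_off_axes:
  fixes a b c x y z p1 p2 p3 q1 q2 q3 e1 e2 e3
    L1 L2 L3 M1 M2 M3 K1 K2 K3 n G2 D1 D2 :: complex
  assumes L1_def: "L1 = 2*x^2 + a*y^2 + b*z^2" and L2_def: "L2 = a*x^2 + 2*y^2 + c*z^2" and L3_def: "L3 = b*x^2 + c*y^2 + 2*z^2"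
    and M1_def: "M1 = 2*(p1*x^2) + a*(p2*y^2) + b*(p3*z^2)" and M2_def: "M2 = a*(p1*x^2) + 2*(p2*y^2) + c*(p3*z^2)"
    and M3_def: "M3 = b*(p1*x^2) + c*(p2*y^2) + 2*(p3*z^2)"
    and K1_def: "K1 = 2*(q1*x^2) + a*(q2*y^2) + b*(q3*z^2)" and K2_def: "K2 = a*(q1*x^2) + 2*(q2*y^2) + c*(q3*z^2)"
    and K3_def: "K3 = b*(q1*x^2) + c*(q2*y^2) + 2*(q3*z^2)"
    and e1_def: "e1 = p1^2 - q1" and e2_def: "e2 = p2^2 - q2" and e3_def: "e3 = p3^2 - q3"
    and n_def: "n = M1*(p1*x^2) + M2*(p2*y^2) + M3*(p3*z^2)"
  assumes nz: "x \<noteq> 0" "y \<noteq> 0" "z \<noteq> 0"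
    and t0: "L1*x^2 + L2*y^2 + L3*z^2 = 0"
    and t1: "L1*(p1*x^2) + L2*(p2*y^2) + L3*(p3*z^2) = 0"
    and t2: "L1*(q1*x^2) + L2*(q2*y^2) + L3*(q3*z^2) + 2 * n = 0"
    and t3: "M1*(q1*x^2) + M2*(q2*y^2) + M3*(q3*z^2) = 0"
    and t4: "K1*(q1*x^2) + K2*(q2*y^2) + K3*(q3*z^2) = 0"
    and n: "n \<noteq> 0" and e1: "e1 \<noteq> 0"
  assumes G2_def: "G2 = L1*(e1*x^2) + L2*(e2*y^2) + L3*(e3*z^2)"
    and D1_def: "D1 = 2*(M1*(e1*x^2) + M2*(e2*y^2) + M3*(e3*z^2))
        + 2*(L1*(e1*x^2)*(p2+p3) + L2*(e2*y^2)*(p1+p3) + L3*(e3*z^2)*(p1+p2))"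
    and D2_def: "D2 = 2*(K1*(e1*x^2) + K2*(e2*y^2) + K3*(e3*z^2))
        + 8*(M1*(e1*x^2)*(p2+p3) + M2*(e2*y^2)*(p1+p3) + M3*(e3*z^2)*(p1+p2))
        + L1*(e1*x^2)*(2*q2+2*q3+8*p2*p3) + L2*(e2*y^2)*(2*q1+2*q3+8*p1*p3)
        + L3*(e3*z^2)*(2*q1+2*q2+8*p1*p2)"
  shows "G2 \<noteq> 0 \<Longrightarrow> contact_order a b c (hpoint (vector [x,y,z])) = 2"
    and "G2 = 0 \<Longrightarrow> D1 \<noteq> 0 \<Longrightarrow> contact_order a b c (hpoint (vector [x,y,z])) = 3"
    and "G2 = 0 \<Longrightarrow> D1 = 0 \<Longrightarrow> contact_order a b c (hpoint (vector [x,y,z])) = 4"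
    and "G2 = 0 \<Longrightarrow> D1 = 0 \<Longrightarrow> D2 \<noteq> 0"
proof -
  define v w :: "complex^3" where "v = vector [x, y, z]" and "w = vector [p1*x, p2*y, p3*z]"
  define g3 where "g3 = 2 * (M1*(p1^2*x^2) + M2*(p2^2*y^2) + M3*(p3^2*z^2))"
  define g4 where "g4 = (p1^2*x^2)^2 + (p2^2*y^2)^2 + (p3^2*z^2)^2 + a*(p1^2*x^2)*(p2^2*y^2)
           + b*(p1^2*x^2)*(p3^2*z^2) + c*(p2^2*y^2)*(p3^2*z^2)"
  have sq: "x^2 \<noteq> 0" "y^2 \<noteq> 0" "z^2 \<noteq> 0" using nz by auto
  note osc = contact_orders_on_conic[OF L1_def L2_def L3_def M1_def M2_def M3_def K1_def K2_def K3_def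
      e1_def e2_def e3_def n_def sq t0 t1 t2 t3 t4 n e1 _ g3_def g4_def D1_def D2_def]
  have G2: "L1*(p1^2*x^2) + L2*(p2^2*y^2) + L3*(p3^2*z^2) + 2*(M1*(p1*x^2) + M2*(p2*y^2) + M3*(p3*z^2)) = G2"
    using t2 unfolding G2_def e1_def e2_def e3_def n_def by algebra
  have F: "quartic_form a b c (A *s v + B *s w) = A^2 * B^2 * G2 + A * B^3 * g3 + B^4 * g4" for A B
    unfolding v_def w_def g3_def g4_def
    using quartic_form_line[OF L1_def L2_def L3_def M1_def M2_def M3_def t0 t1, of A B] unfolding G2 .
  have grad: "grad a b c v = vector [2*x*L1, 2*y*L2, 2*z*L3]"
    by (simp add: grad_def v_def L1_def L2_def L3_def)
  have v: "v \<noteq> 0" using nz by (simp add: v_def vec3_eq_0_iff)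
  have w: "w \<noteq> k *s v" for k
  proof
    assume "w = k *s v"
    then have pk: "p1 = k" "p2 = k" "p3 = k" using nz by (auto simp: w_def v_def scale_vec3 vec3_eq_iff)
    have "n = k^2 * (L1*x^2 + L2*y^2 + L3*z^2)"
      unfolding n_def M1_def M2_def M3_def L1_def L2_def L3_def pk by algebra
    then show False using n t0 by simp
  qed
  have g: "grad a b c v \<noteq> 0"
  proof
    assume "grad a b c v = 0"
    then have "L1 = 0" "L2 = 0" "L3 = 0" using nz by (simp_all add: grad vec3_eq_0_iff)
    then show False using t2 n by simp
  qed
  have gv: "(\<Sum>i\<in>UNIV. grad a b c v $ i * v $ i) = 0"
    using t0 unfolding grad by (simp add: v_def sum_3) algebra
  have gw: "(\<Sum>i\<in>UNIV. grad a b c v $ i * w $ i) = 0"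
    using t1 unfolding grad by (simp add: w_def sum_3) algebra
  note contact = contact_order_eqI[OF v w g gv gw F, unfolded v_def]
  show "contact_order a b c (hpoint (vector [x,y,z])) = 2" if "G2 \<noteq> 0"
    using contact that by simp
  show "contact_order a b c (hpoint (vector [x,y,z])) = 3" if "G2 = 0" "D1 \<noteq> 0"
    using contact osc(1) that unfolding G2_def by simp
  show "contact_order a b c (hpoint (vector [x,y,z])) = 4" if "G2 = 0" "D1 = 0"
    using contact osc that unfolding G2_def by simp
  show "D2 \<noteq> 0" if "G2 = 0" "D1 = 0"
    using osc(2) that unfolding G2_def by simp
qed

text \<open>At a point with one coordinate zero the partial derivative in that direction vanishes, so the tangent
line passes through the opposite coordinate vertex. Along it the form is biquadratic, and the
contact is two unless the coefficient of degree two vanishes, when it jumps to four.\<close>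

lemma contact_order_on_axis:
  assumes "z \<noteq> 0" and "y^4 + z^4 + c * y^2 * z^2 = 0" and "c^2 \<noteq> 4" and "a * y^2 + b * z^2 \<noteq> 0"
  shows "contact_order a b c (hpoint (vector [0, y, z])) = 2"
    and "contact_order a c b (hpoint (vector [y, 0, z])) = 2"
    and "contact_order c a b (hpoint (vector [y, z, 0])) = 2"
proof -
  have L: "2*y^2 + c*z^2 \<noteq> 0"
  proof
    assume "2*y^2 + c*z^2 = 0"
    then have "(c^2 - 4) * z^4 = 0" using assms(2) by algebra
    then show False using assms by auto
  qed
  have y: "y \<noteq> 0" using assms by auto
  show "contact_order a b c (hpoint (vector [0, y, z])) = 2"
  proof -
    have g: "grad a b c (vector [0, y, z]) = vector [0, 2*y*(2*y^2 + c*z^2), 2*z*(c*y^2 + 2*z^2)]"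
      by (simp add: grad_def)
    have "contact_order a b c (hpoint (vector [0, y, z])) = (if a*y^2 + b*z^2 \<noteq> 0 then 2 else if (0::complex) \<noteq> 0 then 3 else 4)"
    proof (rule contact_order_eqI[where w = "vector [1, 0, 0]" and ?g4.0 = 1])
      show "grad a b c (vector [0, y, z]) \<noteq> 0" using y L by (simp add: g vec3_eq_0_iff)
      show "(\<Sum>i\<in>UNIV. grad a b c (vector [0, y, z]) $ i * (vector [0, y, z] :: complex^3) $ i) = 0"
        using assms(2) unfolding g by (simp add: sum_3) algebra
      show "(\<Sum>i\<in>UNIV. grad a b c (vector [0, y, z]) $ i * (vector [1, 0, 0] :: complex^3) $ i) = 0"
        unfolding g by (simp add: sum_3)
      show "quartic_form a b c (A *s vector [0, y, z] + B *s vector [1, 0, 0])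
          = A^2 * B^2 * (a*y^2 + b*z^2) + A * B^3 * 0 + B^4 * 1" for A B
        using assms(2) by (simp add: quartic_form_def scale_vec3) algebra
    qed (use assms(1) in \<open>simp_all add: scale_vec3 vec3_eq_iff vec3_eq_0_iff\<close>)
    then show ?thesis using assms(4) by simp
  qed
  show "contact_order a c b (hpoint (vector [y, 0, z])) = 2"
  proof -
    have g: "grad a c b (vector [y, 0, z]) = vector [2*y*(2*y^2 + c*z^2), 0, 2*z*(c*y^2 + 2*z^2)]"
      by (simp add: grad_def)
    have "contact_order a c b (hpoint (vector [y, 0, z])) = (if a*y^2 + b*z^2 \<noteq> 0 then 2 else if (0::complex) \<noteq> 0 then 3 else 4)"
    proof (rule contact_order_eqI[where w = "vector [0, 1, 0]" and ?g4.0 = 1])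
      show "grad a c b (vector [y, 0, z]) \<noteq> 0" using y L by (simp add: g vec3_eq_0_iff)
      show "(\<Sum>i\<in>UNIV. grad a c b (vector [y, 0, z]) $ i * (vector [y, 0, z] :: complex^3) $ i) = 0"
        using assms(2) unfolding g by (simp add: sum_3) algebra
      show "(\<Sum>i\<in>UNIV. grad a c b (vector [y, 0, z]) $ i * (vector [0, 1, 0] :: complex^3) $ i) = 0"
        unfolding g by (simp add: sum_3)
      show "quartic_form a c b (A *s vector [y, 0, z] + B *s vector [0, 1, 0])
          = A^2 * B^2 * (a*y^2 + b*z^2) + A * B^3 * 0 + B^4 * 1" for A B
        using assms(2) by (simp add: quartic_form_def scale_vec3) algebra
    qed (use assms(1) in \<open>simp_all add: scale_vec3 vec3_eq_iff vec3_eq_0_iff\<close>)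
    then show ?thesis using assms(4) by simp
  qed
  show "contact_order c a b (hpoint (vector [y, z, 0])) = 2"
  proof -
    have g: "grad c a b (vector [y, z, 0]) = vector [2*y*(2*y^2 + c*z^2), 2*z*(c*y^2 + 2*z^2), 0]"
      by (simp add: grad_def)
    have "contact_order c a b (hpoint (vector [y, z, 0])) = (if a*y^2 + b*z^2 \<noteq> 0 then 2 else if (0::complex) \<noteq> 0 then 3 else 4)"
    proof (rule contact_order_eqI[where w = "vector [0, 0, 1]" and ?g4.0 = 1])
      show "grad c a b (vector [y, z, 0]) \<noteq> 0" using y L by (simp add: g vec3_eq_0_iff)
      show "(\<Sum>i\<in>UNIV. grad c a b (vector [y, z, 0]) $ i * (vector [y, z, 0] :: complex^3) $ i) = 0"
        using assms(2) unfolding g by (simp add: sum_3) algebra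
      show "(\<Sum>i\<in>UNIV. grad c a b (vector [y, z, 0]) $ i * (vector [0, 0, 1] :: complex^3) $ i) = 0"
        unfolding g by (simp add: sum_3)
      show "quartic_form c a b (A *s vector [y, z, 0] + B *s vector [0, 0, 1])
          = A^2 * B^2 * (a*y^2 + b*z^2) + A * B^3 * 0 + B^4 * 1" for A B
        using assms(2) by (simp add: quartic_form_def scale_vec3) algebra
    qed (use assms(1) in \<open>simp_all add: scale_vec3 vec3_eq_iff vec3_eq_0_iff\<close>)
    then show ?thesis using assms(4) by simp
  qed
qed

section \<open>The conic and its Wronskian\<close>

lemma count_simple_and_double_roots:
  fixes p :: "complex poly"
  assumes "degree p = 6" and "\<And>t. poly p t = 0 \<Longrightarrow> order t p = 1 \<or> order t p = 2"
  defines "R1 \<equiv> {t. order t p = 1}" and "R2 \<equiv> {t. order t p = 2}"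
  shows "finite R1" "finite R2" "card R1 + 2 * card R2 = 6"
proof -
  have p: "p \<noteq> 0" using assms(1) by auto
  have roots: "{t. poly p t = 0} = R1 \<union> R2"
    using assms(2) order_root[of p] p unfolding R1_def R2_def by auto
  then show fin: "finite R1" "finite R2" using poly_roots_finite[OF p] by auto
  have "6 = size (proots p)" using assms(1) by (simp add: size_proots_complex)
  also have "\<dots> = (\<Sum>t\<in>{t. poly p t = 0}. order t p)"
    using p by (simp add: size_multiset_overloaded_eq)
  also have "\<dots> = (\<Sum>t\<in>R1. order t p) + (\<Sum>t\<in>R2. order t p)"
    unfolding roots by (rule sum.union_disjoint) (use fin in \<open>auto simp: R1_def R2_def\<close>)
  finally show "card R1 + 2 * card R2 = 6" by (simp add: R1_def R2_def)
qed

text \<open>This is where \<open>P1\<close>, \<open>P2\<close>, \<open>P3\<close> come from: each is the resultant of the conic and the polar of a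
coordinate vertex on the opposite axis.\<close>

lemma axis_linear_form_nonzero:
  fixes y z A B C :: complex
  assumes "y^2 + z^2 + C * y * z = 0" "A^2 + B^2 - A * B * C \<noteq> 0" "z \<noteq> 0"
  shows "A * y + B * z \<noteq> 0"
proof
  assume "A * y + B * z = 0"
  then have "(A^2 + B^2 - A * B * C) * z^2 = 0" using assms(1) by algebra
  then show False using assms by auto
qed

text \<open>The number \<open>r\<close> selects the base point \<open>(0 : r : 1)\<close> of the conic, where the parametrization below has its
point at infinity; the other point of the conic on the axis \<open>X = 0\<close>, namely \<open>(0 : -c-r : 1)\<close>, is the value
at \<open>0\<close>. The discriminant of the conic is a multiple of \<open>a\<^sup>2 + b\<^sup>2 + c\<^sup>2 - abc - 4\<close>, and the conditions on \<open>a\<close>,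
\<open>b\<close>, \<open>c\<close> separately say that no coordinate axis is tangent to it.\<close>

locale bisquare_quartic =
  fixes a b c r :: complex
  assumes a: "a^2 \<noteq> 4" and b: "b^2 \<noteq> 4" and c: "c^2 \<noteq> 4"
    and S: "a^2 + b^2 + c^2 - a*b*c - 4 \<noteq> 0"
    and P: "P1 a b c \<noteq> 0" "P2 a b c \<noteq> 0" "P3 a b c \<noteq> 0"
    and r: "r^2 + c*r + 1 = 0"
begin

text \<open>The parameter is scaled so that no denominators occur and the zero of \<open>X\<close> is \<open>0\<close>; the point at infinity
is \<open>(0 : r : 1)\<close>. That \<open>X\<close>, \<open>Y\<close>, \<open>Z\<close> do satisfy \<open>Q = 0\<close> is part of \<open>conic_param\<close>.\<close>

definition s where "s = a^2 + b^2 + c^2 - a*b*c - 4"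
definition X where "X = [:0, c^2 - 4:]"
definition Y where "Y = [:s * (- c - r), 2*a - b*c, r:]"
definition Z where "Z = [:s, 2*b - a*c, 1:]"
definition L1 where "L1 = smult 2 X + smult a Y + smult b Z"
definition L2 where "L2 = smult a X + smult 2 Y + smult c Z"
definition L3 where "L3 = smult b X + smult c Y + smult 2 Z"
text \<open>The three constants are the discriminants of \<open>X\<close>, \<open>Y\<close>, \<open>Z\<close> as binary quadratic forms. Since \<open>(L1, L2, L3)\<close>
is proportional to the cross product of \<open>(X, Y, Z)\<close> and its derivative, and \<open>4 X\<^sup>3\<^sup>/\<^sup>2 (\<surd>X)'' = 2XX'' - X'\<^sup>2\<close> is minus
the discriminant of \<open>X\<close>, the sum is the Wronskian determinant of the three square roots up to a
constant and a power of \<open>XYZ\<close>.\<close>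

definition W where "W = smult ((c^2 - 4)^2) (L1 * Y * Z) + smult ((2*a - b*c)^2 - 4 * s) (L2 * X * Z)
  + smult ((2*b - a*c)^2 - 4 * s) (L3 * X * Y)"

lemma r_nz: "r \<noteq> 0" using r by auto

lemma rr: "r * (- c - r) = 1" using r by algebra

text \<open>Only the first summand of \<open>W\<close> reaches degree six, since \<open>X\<close> is linear. Its leading coefficient
contains \<open>ar + b\<close>, which is a factor of \<open>P1\<close>.\<close>

lemma degree_W: "degree W = 6"
proof -
  have c0: "c^2 - 4 \<noteq> 0" using c by simp
  \<comment> \<open>The roots of \<open>T\<^sup>2 + cT + 1\<close> are \<open>r\<close> and \<open>-c-r\<close>, so \<open>P1\<close> is a norm.\<close>
  have "(a*r + b) * (a * (-c-r) + b) = P1 a b c" using rr by (simp add: P1_def) algebra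
  then have ab: "a*r + b \<noteq> 0" using P(1) by auto
  have "L1 = [:a * (s * (-c-r)) + b * s, 2*(c^2-4) + a*(2*a-b*c) + b*(2*b-a*c), a*r+b:]"
    by (simp add: L1_def X_def Y_def Z_def)
  then have "degree L1 = 2" using ab by simp
  moreover have Y: "degree Y = 2" "degree Z = 2" using r_nz by (simp_all add: Y_def Z_def)
  moreover have nz: "L1 \<noteq> 0" "Y \<noteq> 0" "Z \<noteq> 0" using \<open>degree L1 = 2\<close> Y by auto
  ultimately have main: "degree (L1 * Y * Z) = 6" by (simp add: degree_mult_eq)
  have X: "degree X \<le> 1" by (simp add: X_def)
  have L: "degree L2 \<le> 2" "degree L3 \<le> 2" unfolding L2_def L3_def
    by (intro degree_add_le order_trans[OF degree_smult_le]; use X Y in simp)+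
  have "degree (L2 * X * Z) \<le> 5" "degree (L3 * X * Y) \<le> 5"
    using degree_mult_le[of "L2 * X" Z] degree_mult_le[of L2 X] degree_mult_le[of "L3 * X" Y]
      degree_mult_le[of L3 X] L X Y by linarith+
  then have "degree (smult ((2*a - b*c)^2 - 4 * s) (L2 * X * Z) + smult ((2*b - a*c)^2 - 4 * s) (L3 * X * Y)) \<le> 5"
    by (intro degree_add_le order_trans[OF degree_smult_le])
  then have "degree W = degree (smult ((c^2 - 4)^2) (L1 * Y * Z))"
    unfolding W_def add.assoc by (intro degree_add_eq_left) (use main c0 in simp)
  then show ?thesis using main c0 by simp
qed

text \<open>The Taylor coefficients of the identity \<open>Q(X, Y, Z) = 0\<close> at \<open>t\<close>, the second one split into its two
terms because the nonzero value of \<open>Q\<close> at the derivative is needed, followed by the discriminants of \<open>X\<close>, \<open>Y\<close>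
and \<open>Z\<close>, which do not depend on \<open>t\<close>.\<close>

lemma conic_param:
  fixes t
  defines "x \<equiv> poly X t" and "y \<equiv> poly Y t" and "z \<equiv> poly Z t"
    and "x' \<equiv> poly (pderiv X) t" and "y' \<equiv> poly (pderiv Y) t" and "z' \<equiv> poly (pderiv Z) t"
    and "x'' \<equiv> poly (pderiv (pderiv X)) t" and "y'' \<equiv> poly (pderiv (pderiv Y)) t" and "z'' \<equiv> poly (pderiv (pderiv Z)) t"
  shows "x^2 + y^2 + z^2 + a*x*y + b*x*z + c*y*z = 0"
    and "(2*x + a*y + b*z) * x' + (a*x + 2*y + c*z) * y' + (b*x + c*y + 2*z) * z' = 0"
    and "(2*x + a*y + b*z) * x'' + (a*x + 2*y + c*z) * y'' + (b*x + c*y + 2*z) * z'' = - 2 * s * (c^2 - 4)"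
    and "x'^2 + y'^2 + z'^2 + a*x'*y' + b*x'*z' + c*y'*z' = s * (c^2 - 4)"
    and "(2*x' + a*y' + b*z') * x'' + (a*x' + 2*y' + c*z') * y'' + (b*x' + c*y' + 2*z') * z'' = 0"
    and "x''^2 + y''^2 + z''^2 + a*x''*y'' + b*x''*z'' + c*y''*z'' = 0"
    and "x'^2 - 2*x*x'' = (c^2 - 4)^2"
    and "y'^2 - 2*y*y'' = (2*a - b*c)^2 - 4 * s"
    and "z'^2 - 2*z*z'' = (2*b - a*c)^2 - 4 * s"
proof -
  define \<rho> where "\<rho> = - c - r"
  have cr: "c = - (r + \<rho>)" and rr: "r * \<rho> = 1" using rr by (simp_all add: \<rho>_def)
  have sv: "s = a^2 + b^2 + (r + \<rho>)^2 + a*b*(r + \<rho>) - 4" unfolding s_def using cr by algebra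
  have vals: "x = t * (c^2-4)" "x' = c^2 - 4" "x'' = 0"
    "y = s * \<rho> + (2*a-b*c)*t + r*t^2" "y' = (2*a-b*c) + 2*r*t" "y'' = 2*r"
    "z = s + (2*b-a*c)*t + t^2" "z' = (2*b-a*c) + 2*t" "z'' = 2"
    unfolding assms X_def Y_def Z_def \<rho>_def
    by (simp_all add: pderiv_pCons algebra_simps power2_eq_square)
  show "x^2 + y^2 + z^2 + a*x*y + b*x*z + c*y*z = 0"
    unfolding vals unfolding sv unfolding cr using rr by algebra
  show "(2*x + a*y + b*z) * x' + (a*x + 2*y + c*z) * y' + (b*x + c*y + 2*z) * z' = 0"
    unfolding vals unfolding sv unfolding cr using rr by algebra
  show "(2*x + a*y + b*z) * x'' + (a*x + 2*y + c*z) * y'' + (b*x + c*y + 2*z) * z'' = - 2 * s * (c^2 - 4)"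
    unfolding vals unfolding sv unfolding cr using rr by algebra
  show "x'^2 + y'^2 + z'^2 + a*x'*y' + b*x'*z' + c*y'*z' = s * (c^2 - 4)"
    unfolding vals unfolding sv unfolding cr using rr by algebra
  show "(2*x' + a*y' + b*z') * x'' + (a*x' + 2*y' + c*z') * y'' + (b*x' + c*y' + 2*z') * z'' = 0"
    unfolding vals unfolding sv unfolding cr using rr by algebra
  show "x''^2 + y''^2 + z''^2 + a*x''*y'' + b*x''*z'' + c*y''*z'' = 0"
    unfolding vals cr using rr by simp algebra
  show "x'^2 - 2*x*x'' = (c^2 - 4)^2" unfolding vals by algebra
  show "y'^2 - 2*y*y'' = (2*a - b*c)^2 - 4 * s" unfolding vals using rr by algebra
  show "z'^2 - 2*z*z'' = (2*b - a*c)^2 - 4 * s" unfolding vals by algebra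
qed


lemma W_derivs:
  "pderiv W = smult ((c^2 - 4)^2) (pderiv L1 * Y * Z + L1 * pderiv Y * Z + L1 * Y * pderiv Z)
    + smult ((2*a - b*c)^2 - 4 * s) (pderiv L2 * X * Z + L2 * pderiv X * Z + L2 * X * pderiv Z)
    + smult ((2*b - a*c)^2 - 4 * s) (pderiv L3 * X * Y + L3 * pderiv X * Y + L3 * X * pderiv Y)"
  by (simp add: W_def pderiv_add pderiv_mult pderiv_smult algebra_simps)

lemma order_W:
  assumes "poly W t = 0"
  shows "poly (pderiv W) t \<noteq> 0 \<Longrightarrow> order t W = 1"
    and "poly (pderiv W) t = 0 \<Longrightarrow> poly (pderiv (pderiv W)) t \<noteq> 0 \<Longrightarrow> order t W = 2"
proof -
  have "W \<noteq> 0" using degree_W by auto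
  then have o: "order t W = Suc (order t (pderiv W))" using assms by (rule order_pderiv)
  show "order t W = 1" if "poly (pderiv W) t \<noteq> 0"
    using o order_0I[OF that] by simp
  show "order t W = 2" if "poly (pderiv W) t = 0" "poly (pderiv (pderiv W)) t \<noteq> 0"
  proof -
    have "pderiv W \<noteq> 0" using that(2) by auto
    then show ?thesis using o order_pderiv[OF _ that(1)] order_0I[OF that(2)] by simp
  qed
qed

text \<open>The link between \<open>W\<close> and the local analysis: since \<open>d\<^sub>i = 4 V\<^sub>i\<^sup>2 e\<^sub>i\<close> with \<open>V = (x\<^sup>2, y\<^sup>2, z\<^sup>2)\<close>, the values
of \<open>W\<close> and of its first two derivatives are \<open>4 x\<^sup>2 y\<^sup>2 z\<^sup>2\<close> times \<open>G2\<close>, \<open>D1\<close> and \<open>D2\<close>.\<close>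

lemma contact_order_param:
  fixes t x y z
  assumes sq: "x^2 = poly X t" "y^2 = poly Y t" "z^2 = poly Z t"
    and nz: "x \<noteq> 0" "y \<noteq> 0" "z \<noteq> 0"
  shows "poly W t \<noteq> 0 \<Longrightarrow> contact_order a b c (hpoint (vector [x, y, z])) = 2"
    and "order t W = 1 \<Longrightarrow> contact_order a b c (hpoint (vector [x, y, z])) = 3"
    and "order t W = 2 \<Longrightarrow> contact_order a b c (hpoint (vector [x, y, z])) = 4"
    and "poly W t = 0 \<Longrightarrow> order t W = 1 \<or> order t W = 2"
proof -
  note C = conic_param[of t, folded sq]
  define p1 p2 p3 where "p1 = poly (pderiv X) t / (2 * x^2)" and "p2 = poly (pderiv Y) t / (2 * y^2)"
    and "p3 = poly (pderiv Z) t / (2 * z^2)"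
  define q1 q2 q3 where "q1 = poly (pderiv (pderiv X)) t / (2 * x^2)"
    and "q2 = poly (pderiv (pderiv Y)) t / (2 * y^2)" and "q3 = poly (pderiv (pderiv Z)) t / (2 * z^2)"
  have p: "poly (pderiv X) t = 2 * (p1*x^2)" "poly (pderiv Y) t = 2 * (p2*y^2)" "poly (pderiv Z) t = 2 * (p3*z^2)"
    using nz by (simp_all add: p1_def p2_def p3_def)
  have q: "poly (pderiv (pderiv X)) t = 2 * (q1*x^2)" "poly (pderiv (pderiv Y)) t = 2 * (q2*y^2)"
    "poly (pderiv (pderiv Z)) t = 2 * (q3*z^2)"
    using nz by (simp_all add: q1_def q2_def q3_def)
  define l1 l2 l3 where "l1 = 2*x^2 + a*y^2 + b*z^2" and "l2 = a*x^2 + 2*y^2 + c*z^2" and "l3 = b*x^2 + c*y^2 + 2*z^2"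
  define m1 m2 m3 where "m1 = 2*(p1*x^2) + a*(p2*y^2) + b*(p3*z^2)" and "m2 = a*(p1*x^2) + 2*(p2*y^2) + c*(p3*z^2)"
    and "m3 = b*(p1*x^2) + c*(p2*y^2) + 2*(p3*z^2)"
  define k1 k2 k3 where "k1 = 2*(q1*x^2) + a*(q2*y^2) + b*(q3*z^2)" and "k2 = a*(q1*x^2) + 2*(q2*y^2) + c*(q3*z^2)"
    and "k3 = b*(q1*x^2) + c*(q2*y^2) + 2*(q3*z^2)"
  define e1 e2 e3 where "e1 = p1^2 - q1" and "e2 = p2^2 - q2" and "e3 = p3^2 - q3"
  define n where "n = m1*(p1*x^2) + m2*(p2*y^2) + m3*(p3*z^2)"
  define G2 where "G2 = l1*(e1*x^2) + l2*(e2*y^2) + l3*(e3*z^2)"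
  define D1 where "D1 = 2*(m1*(e1*x^2) + m2*(e2*y^2) + m3*(e3*z^2))
        + 2*(l1*(e1*x^2)*(p2+p3) + l2*(e2*y^2)*(p1+p3) + l3*(e3*z^2)*(p1+p2))"
  define D2 where "D2 = 2*(k1*(e1*x^2) + k2*(e2*y^2) + k3*(e3*z^2))
        + 8*(m1*(e1*x^2)*(p2+p3) + m2*(e2*y^2)*(p1+p3) + m3*(e3*z^2)*(p1+p2))
        + l1*(e1*x^2)*(2*q2+2*q3+8*p2*p3) + l2*(e2*y^2)*(2*q1+2*q3+8*p1*p3)
        + l3*(e3*z^2)*(2*q1+2*q2+8*p1*p2)"
  have L: "poly L1 t = l1" "poly L2 t = l2" "poly L3 t = l3"
    by (simp_all add: L1_def L2_def L3_def l1_def l2_def l3_def sq)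
  have L': "poly (pderiv L1) t = 2 * m1" "poly (pderiv L2) t = 2 * m2" "poly (pderiv L3) t = 2 * m3"
    by (simp_all add: L1_def L2_def L3_def m1_def m2_def m3_def pderiv_add pderiv_smult p algebra_simps)
  have L'': "poly (pderiv (pderiv L1)) t = 2 * k1" "poly (pderiv (pderiv L2)) t = 2 * k2" "poly (pderiv (pderiv L3)) t = 2 * k3"
    by (simp_all add: L1_def L2_def L3_def k1_def k2_def k3_def pderiv_add pderiv_smult q algebra_simps)
  have d: "(c^2 - 4)^2 = 4 * (x^2)^2 * e1" "(2*a - b*c)^2 - 4 * s = 4 * (y^2)^2 * e2" "(2*b - a*c)^2 - 4 * s = 4 * (z^2)^2 * e3"
    unfolding C(7-9)[symmetric] p q e1_def e2_def e3_def by algebra+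
  have W: "poly W t = 4 * x^2 * y^2 * z^2 * G2"
    unfolding W_def d by (simp add: L sq[symmetric] G2_def) algebra
  have W': "poly (pderiv W) t = 4 * x^2 * y^2 * z^2 * D1"
    unfolding W_derivs d by (simp add: L L' p sq[symmetric] D1_def) algebra
  have W'': "poly (pderiv (pderiv W)) t = 4 * x^2 * y^2 * z^2 * D2"
    unfolding W_derivs d by (simp add: L L' L'' p q sq[symmetric] D2_def pderiv_add pderiv_smult pderiv_mult) algebra
  have t0: "l1*x^2 + l2*y^2 + l3*z^2 = 0"
    using C(1) unfolding l1_def l2_def l3_def by algebra
  have t1: "l1*(p1*x^2) + l2*(p2*y^2) + l3*(p3*z^2) = 0"
    using C(2) unfolding p l1_def l2_def l3_def by algebra
  have n: "2 * n = s * (c^2 - 4)"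
    using C(4) unfolding p n_def m1_def m2_def m3_def by algebra
  have t2: "l1*(q1*x^2) + l2*(q2*y^2) + l3*(q3*z^2) + 2 * n = 0"
    using C(3) unfolding n q l1_def[symmetric] l2_def[symmetric] l3_def[symmetric] by algebra
  have t3: "m1*(q1*x^2) + m2*(q2*y^2) + m3*(q3*z^2) = 0"
    using C(5) unfolding p q m1_def m2_def m3_def by algebra
  have t4: "k1*(q1*x^2) + k2*(q2*y^2) + k3*(q3*z^2) = 0"
    using C(6) unfolding q k1_def k2_def k3_def by algebra
  have n0: "n \<noteq> 0" using n S c unfolding s_def by auto
  have e0: "e1 \<noteq> 0" using d(1) c by auto
  note con = contact_order_off_axes[OF l1_def l2_def l3_def m1_def m2_def m3_def k1_def k2_def k3_def
      e1_def e2_def e3_def n_def nz t0 t1 t2 t3 t4 n0 e0 G2_def D1_def D2_def]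
  note ord = order_W[of t]
  have W0: "order t W \<noteq> 0 \<longleftrightarrow> poly W t = 0" using degree_W order_root[of W t] by auto
  have o1: "order t W = 1" if "G2 = 0" "D1 \<noteq> 0" using ord that W W' nz by simp
  have o2: "order t W = 2" if "G2 = 0" "D1 = 0" using ord that con(4) W W' W'' nz by simp
  show "contact_order a b c (hpoint (vector [x, y, z])) = 2" if "poly W t \<noteq> 0"
    using that con(1) W by simp
  show "contact_order a b c (hpoint (vector [x, y, z])) = 3" if "order t W = 1"
    using that con(2) W W0 nz o2 by fastforce
  show "contact_order a b c (hpoint (vector [x, y, z])) = 4" if "order t W = 2"
    using that con(3) W W0 nz o1 by fastforce
  show "order t W = 1 \<or> order t W = 2" if "poly W t = 0"
    using that W nz o1 o2 by auto
qed

text \<open>On an axis two of the three summands of \<open>W\<close> vanish. The remaining one is a product of nonzero factors: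
a discriminant, two coordinates, and the linear form excluded from vanishing by \<open>P1\<close>, \<open>P2\<close> or \<open>P3\<close>.\<close>

lemma root_off_axes:
  assumes "poly W t = 0"
  shows "poly X t \<noteq> 0 \<and> poly Y t \<noteq> 0 \<and> poly Z t \<noteq> 0"
proof -
  define x y z where "x = poly X t" and "y = poly Y t" and "z = poly Z t"
  have Q: "x^2 + y^2 + z^2 + a*x*y + b*x*z + c*y*z = 0"
    using conic_param(1)[of t] by (simp add: x_def y_def z_def)
  have d1: "(c^2 - 4)^2 \<noteq> 0" using c by simp
  have "(2*a - b*c)^2 - 4 * s = (b^2 - 4) * (c^2 - 4)" "(2*b - a*c)^2 - 4 * s = (a^2 - 4) * (c^2 - 4)"
    unfolding s_def by algebra+
  then have d': "(2*a - b*c)^2 - 4 * s \<noteq> 0" "(2*b - a*c)^2 - 4 * s \<noteq> 0" using a b c by simp_all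
  have W: "(c^2 - 4)^2 * ((2*x + a*y + b*z) * y * z) + ((2*a - b*c)^2 - 4 * s) * ((a*x + 2*y + c*z) * x * z)
    + ((2*b - a*c)^2 - 4 * s) * ((b*x + c*y + 2*z) * x * y) = 0"
    using assms by (simp add: W_def L1_def L2_def L3_def x_def y_def z_def)
  have "x \<noteq> 0 \<or> z \<noteq> 0"
    using c S by (auto simp: x_def z_def X_def Z_def s_def)
  then have ne: "\<not> (x = 0 \<and> y = 0)" "\<not> (x = 0 \<and> z = 0)" "\<not> (y = 0 \<and> z = 0)" using Q by auto
  have "x \<noteq> 0"
  proof
    assume x: "x = 0"
    then have "a * y + b * z \<noteq> 0" using ne Q P(1) by (intro axis_linear_form_nonzero[where C = c]) (auto simp: P1_def)
    then show False using W d1 ne x by simp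
  qed
  moreover have "y \<noteq> 0"
  proof
    assume y: "y = 0"
    then have "a * x + c * z \<noteq> 0" using ne Q P(2) by (intro axis_linear_form_nonzero[where C = b]) (auto simp: P2_def algebra_simps)
    then show False using W d' ne y by simp
  qed
  moreover have "z \<noteq> 0"
  proof
    assume z: "z = 0"
    then have "b * x + c * y \<noteq> 0" using ne Q P(3) by (intro axis_linear_form_nonzero[where C = a]) (auto simp: P3_def algebra_simps)
    then show False using W d' ne z by simp
  qed
  ultimately show ?thesis by (simp add: x_def y_def z_def)
qed

text \<open>The parametrization is inverted by linear forms: \<open>(r - \<rho>)(Y - rZ) + (ar + b)X\<close>, the left-hand side of the
equation of the tangent at the base point, takes a constant nonzero value along it, so it recovers the
scaling \<open>k\<close>, after which \<open>X\<close> recovers \<open>t\<close>. The tangent meets the conic only at the base point, where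
\<open>X = 0\<close>.\<close>

lemma conic_param_surj:
  assumes Q: "x^2 + y^2 + z^2 + a*x*y + b*x*z + c*y*z = 0" and x: "x \<noteq> 0"
  shows "\<exists>t k. k \<noteq> 0 \<and> x = k * poly X t \<and> y = k * poly Y t \<and> z = k * poly Z t"
proof -
  define \<rho> where "\<rho> = - c - r"
  have cr: "c = - (r + \<rho>)" and rr: "r * \<rho> = 1" using rr by (simp_all add: \<rho>_def)
  define h where "h = - ((r - \<rho>) * (y - r * z) + (a*r + b) * x)"
  have \<Delta>: "(r - \<rho>)^2 = c^2 - 4" unfolding cr using rr by algebra
  have sv: "s = a^2 + b^2 + (r + \<rho>)^2 + a*b*(r + \<rho>) - 4" unfolding s_def using cr by algebra
  have nz: "s \<noteq> 0" "c^2 - 4 \<noteq> 0" using S c by (simp_all add: s_def)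
  \<comment> \<open>This is \<open>z = k Z(t)\<close> with \<open>k\<close> and \<open>t\<close> expressed by \<open>h\<close> and \<open>x\<close> and denominators cleared.\<close>
  have key: "(r - \<rho>)^2 * h * z = h^2 + (2*b - a*c) * h * x + s * x^2"
    using Q unfolding h_def unfolding sv unfolding cr using rr by algebra
  then have "h \<noteq> 0" using nz x by auto
  define k where "k = h / (s * (c^2 - 4))"
  define t where "t = x / ((c^2 - 4) * k)"
  have k: "k \<noteq> 0" using \<open>h \<noteq> 0\<close> nz by (simp add: k_def)
  have h: "h = s * (c^2 - 4) * k" and xt: "x = (c^2 - 4) * k * t"
    using nz k by (simp_all add: k_def t_def)
  have "x = k * poly X t" using xt by (simp add: X_def)
  moreover have z: "z = k * poly Z t"
  proof -
    have "(s * (c^2 - 4)^2 * k) * (z - k * (s + (2*b - a*c) * t + t^2)) = 0"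
      using key unfolding \<Delta> h xt by algebra
    then have "z = k * (s + (2*b - a*c) * t + t^2)" using nz k by simp
    then show ?thesis by (simp add: Z_def algebra_simps power2_eq_square)
  qed
  moreover have "y = k * poly Y t"
  proof -
    have "poly Z t = s + (2*b - a*c) * t + t^2" by (simp add: Z_def algebra_simps power2_eq_square)
    then have z': "z = k * (s + (2*b - a*c) * t + t^2)" using z by simp
    have "(r - \<rho>) * (y - k * (s * \<rho> + (2*a - b*c) * t + r * t^2)) = 0"
    proof -
      have "(r - \<rho>) * (y - r * z) + (a*r + b) * x = - (s * (r - \<rho>)^2 * k)" using h \<Delta> unfolding h_def by algebra
      moreover have "x = (r - \<rho>)^2 * k * t" using xt \<Delta> by simp
      ultimately show ?thesis using z' rr cr by algebra
    qed
    moreover have "r - \<rho> \<noteq> 0" using \<Delta> nz by auto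
    ultimately have "y = k * (s * \<rho> + (2*a - b*c) * t + r * t^2)" by simp
    then show ?thesis by (simp add: Y_def \<rho>_def algebra_simps power2_eq_square)
  qed
  ultimately show ?thesis using k by blast
qed

text \<open>Since \<open>X\<close> is proportional to the parameter, \<open>u = k t\<close>; the combination
\<open>Y - rZ\<close> is an affine function of the parameter with nonzero constant term, which forces \<open>k = 1\<close>.\<close>

lemma param_inj:
  assumes "poly X u = k * poly X t" "poly Y u = k * poly Y t" "poly Z u = k * poly Z t"
  shows "t = u"
proof -
  define \<rho> where "\<rho> = - c - r"
  have cr: "c = - (r + \<rho>)" and rr: "r * \<rho> = 1" using rr by (simp_all add: \<rho>_def)
  have \<Delta>: "(r - \<rho>)^2 = c^2 - 4" unfolding cr using rr by algebra
  have nz: "s \<noteq> 0" "c^2 - 4 \<noteq> 0" using S c by (simp_all add: s_def)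
  then have rp: "r - \<rho> \<noteq> 0" using \<Delta> by auto
  have u: "u = k * t" using assms(1) nz by (simp add: X_def)
  have "s * \<rho> + (2*a - b*c) * u + r * u^2 = k * (s * \<rho> + (2*a - b*c) * t + r * t^2)"
    using assms(2) by (simp add: Y_def \<rho>_def algebra_simps power2_eq_square)
  moreover have "s + (2*b - a*c) * u + u^2 = k * (s + (2*b - a*c) * t + t^2)"
    using assms(3) by (simp add: Z_def algebra_simps power2_eq_square)
  ultimately have "s * (r - \<rho>) * (1 - k) = 0" using u by algebra
  then show ?thesis using nz rp u by simp
qed


section \<open>Flexes as roots of the Wronskian\<close>

lemma curve_iff:
  "hpoint (vector [x, y, z]) \<in> quartic_curve a b c \<longleftrightarrow>
     vector [x, y, z] \<noteq> (0 :: complex^3) \<and>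
     (x^2)^2 + (y^2)^2 + (z^2)^2 + a*x^2*y^2 + b*x^2*z^2 + c*y^2*z^2 = 0"
proof -
  let ?F = "(x^2)^2 + (y^2)^2 + (z^2)^2 + a*x^2*y^2 + b*x^2*z^2 + c*y^2*z^2"
  have F: "quartic_form a b c (k *s vector [x, y, z]) = k^4 * ?F" for k
    unfolding quartic_form_def scale_vec3 vector_3 by algebra
  have "(\<forall>v\<in>hpoint (vector [x, y, z]). quartic_form a b c v = 0) \<longleftrightarrow> ?F = 0"
  proof
    assume "\<forall>v\<in>hpoint (vector [x, y, z]). quartic_form a b c v = 0"
    then have "quartic_form a b c (1 *s vector [x, y, z]) = 0" using self_in_hpoint by simp
    then show "?F = 0" unfolding F by simp
  qed (auto simp only: hpoint_def F mem_Collect_eq mult_zero_right)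
  moreover have "vector [x, y, z] \<noteq> (0 :: complex^3)" if "hpoint (vector [x, y, z]) \<in> proj_plane"
    using that unfolding proj_plane_eq by (auto simp: hpoint_eq_iff)
  moreover have "hpoint (vector [x, y, z]) \<in> proj_plane" if "vector [x, y, z] \<noteq> (0 :: complex^3)"
    using that unfolding proj_plane_eq by auto
  ultimately show ?thesis unfolding quartic_curve_def by blast
qed

definition points :: "complex \<Rightarrow> (complex^3) set set" where
  "points t = sqrt_points (poly X t) (poly Y t) (poly Z t)"

lemma points_of_root:
  assumes "poly W t = 0" "p \<in> points t"
  shows "p \<in> quartic_curve a b c"
    and "order t W = 1 \<Longrightarrow> contact_order a b c p = 3"
    and "order t W = 2 \<Longrightarrow> contact_order a b c p = 4"
proof -
  obtain x y z where p: "p = hpoint (vector [x, y, z])"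
    and sq: "x^2 = poly X t" "y^2 = poly Y t" "z^2 = poly Z t"
    using assms(2) unfolding points_def sqrt_points_def by blast
  have nz: "x \<noteq> 0" "y \<noteq> 0" "z \<noteq> 0" using root_off_axes[OF assms(1)] sq by auto
  show "p \<in> quartic_curve a b c" unfolding p curve_iff
    using nz conic_param(1)[of t, folded sq] by (simp add: vec3_eq_0_iff)
  show "contact_order a b c p = 3" if "order t W = 1"
    unfolding p by (rule contact_order_param(2)[OF sq nz that])
  show "contact_order a b c p = 4" if "order t W = 2"
    unfolding p by (rule contact_order_param(3)[OF sq nz that])
qed

text \<open>Off the axes the scaling in the parametrization of the conic has a square root, which can be moved into
the homogeneous coordinates of the point.\<close>

lemma curve_point_cases:
  assumes "p \<in> quartic_curve a b c"
  shows "contact_order a b c p = 2 \<or> (\<exists>t. poly W t = 0 \<and> p \<in> points t)"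
proof -
  obtain v where v: "p = hpoint v" using assms unfolding quartic_curve_def proj_plane_eq by blast
  obtain x y z where "v = vector [x, y, z]" using vec3_exhaust by blast
  with v have p: "p = hpoint (vector [x, y, z])" by simp
  have nz: "\<not> (x = 0 \<and> y = 0 \<and> z = 0)"
    and F: "(x^2)^2 + (y^2)^2 + (z^2)^2 + a*x^2*y^2 + b*x^2*z^2 + c*y^2*z^2 = 0"
    using assms unfolding p curve_iff vec3_eq_0_iff by blast+
  consider "x = 0" | "y = 0" | "z = 0" | "x \<noteq> 0" "y \<noteq> 0" "z \<noteq> 0" by blast
  then show ?thesis
  proof cases
    case 1
    then have z: "z \<noteq> 0" using nz F by auto
    have "a * y^2 + b * z^2 \<noteq> 0"
      using F P(1) 1 z by (intro axis_linear_form_nonzero[where C = c]) (auto simp: P1_def)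
    moreover have "y^4 + z^4 + c * y^2 * z^2 = 0" using F 1 by simp
    ultimately show ?thesis using contact_order_on_axis(1) z c 1 unfolding p by simp
  next
    case 2
    then have z: "z \<noteq> 0" using nz F by auto
    have "a * x^2 + c * z^2 \<noteq> 0"
      using F P(2) 2 z by (intro axis_linear_form_nonzero[where C = b]) (auto simp: P2_def algebra_simps)
    moreover have "x^4 + z^4 + b * x^2 * z^2 = 0" using F 2 by simp
    ultimately show ?thesis using contact_order_on_axis(2) z b 2 unfolding p by simp
  next
    case 3
    then have y: "y \<noteq> 0" using nz F by auto
    have "b * x^2 + c * y^2 \<noteq> 0"
      using F P(3) 3 y by (intro axis_linear_form_nonzero[where C = a]) (auto simp: P3_def algebra_simps)
    moreover have "x^4 + y^4 + a * x^2 * y^2 = 0" using F 3 by simp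
    ultimately show ?thesis using contact_order_on_axis(3) y a 3 unfolding p by simp
  next
    case 4
    have "x^2 \<noteq> 0" using 4 by simp
    from conic_param_surj[OF F this] obtain t k where k: "k \<noteq> 0"
      and xyz: "x^2 = k * poly X t" "y^2 = k * poly Y t" "z^2 = k * poly Z t" by blast
    define l where "l = 1 / csqrt k"
    have l: "l \<noteq> 0" "l^2 * k = 1" using k by (simp_all add: l_def power_divide)
    have sq: "(l*x)^2 = poly X t" "(l*y)^2 = poly Y t" "(l*z)^2 = poly Z t"
      using xyz l(2) by algebra+
    have p': "p = hpoint (vector [l*x, l*y, l*z])"
      unfolding p hpoint_eq_iff using l(1) by (auto simp: scale_vec3)
    show ?thesis
    proof (cases "poly W t = 0")
      case True
      moreover have "p \<in> points t" unfolding points_def sqrt_points_def p' using sq by blast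
      ultimately show ?thesis by blast
    next
      case False
      then show ?thesis unfolding p' using contact_order_param(1)[OF sq] 4 l(1) by simp
    qed
  qed
qed

lemma root_order:
  assumes "poly W t = 0"
  shows "order t W = 1 \<or> order t W = 2"
proof -
  have "csqrt (poly X t) \<noteq> 0" "csqrt (poly Y t) \<noteq> 0" "csqrt (poly Z t) \<noteq> 0"
    using root_off_axes[OF assms] by simp_all
  then show ?thesis by (rule contact_order_param(4)[OF power2_csqrt power2_csqrt power2_csqrt]) fact
qed

lemma flexes_eq:
  "ordinary_flexes a b c = (\<Union>t\<in>{t. order t W = 1}. points t)"
  "hyperflexes a b c = (\<Union>t\<in>{t. order t W = 2}. points t)"
  "weierstrass1_points a b c = ordinary_flexes a b c \<union> hyperflexes a b c"
proof -
  have root: "poly W t = 0" if "order t W = 1 \<or> order t W = 2" for t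
    using that by (auto simp: order_root)
  have flex: "\<exists>t. (order t W = 1 \<and> contact_order a b c p = 3 \<or> order t W = 2 \<and> contact_order a b c p = 4) \<and> p \<in> points t"
    if p: "p \<in> quartic_curve a b c" "contact_order a b c p \<ge> 3" for p
  proof -
    obtain t where t: "poly W t = 0" "p \<in> points t" using curve_point_cases[OF p(1)] p(2) by auto
    then show ?thesis using root_order[OF t(1)] points_of_root(2,3)[OF t] by blast
  qed
  show "ordinary_flexes a b c = (\<Union>t\<in>{t. order t W = 1}. points t)"
  proof (intro equalityI subsetI)
    fix p assume "p \<in> ordinary_flexes a b c"
    then show "p \<in> (\<Union>t\<in>{t. order t W = 1}. points t)"
      using flex[of p] unfolding ordinary_flexes_def by auto
  next
    fix p assume "p \<in> (\<Union>t\<in>{t. order t W = 1}. points t)"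
    then obtain t where t: "order t W = 1" "p \<in> points t" by blast
    then have "poly W t = 0" using root by blast
    then show "p \<in> ordinary_flexes a b c"
      using points_of_root t unfolding ordinary_flexes_def by simp
  qed
  show "hyperflexes a b c = (\<Union>t\<in>{t. order t W = 2}. points t)"
  proof (intro equalityI subsetI)
    fix p assume "p \<in> hyperflexes a b c"
    then show "p \<in> (\<Union>t\<in>{t. order t W = 2}. points t)"
      using flex[of p] unfolding hyperflexes_def by auto
  next
    fix p assume "p \<in> (\<Union>t\<in>{t. order t W = 2}. points t)"
    then obtain t where t: "order t W = 2" "p \<in> points t" by blast
    then have "poly W t = 0" using root by blast
    then show "p \<in> hyperflexes a b c"
      using points_of_root t unfolding hyperflexes_def by simp
  qed
  show "weierstrass1_points a b c = ordinary_flexes a b c \<union> hyperflexes a b c"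
    unfolding weierstrass1_points_def ordinary_flexes_def hyperflexes_def using flex by fastforce
qed

lemma flex_orbits:
  defines "m \<equiv> card {t. order t W = 1}" and "h \<equiv> card {t. order t W = 2}"
  shows "m + 2 * h = 6"
    and "card (ordinary_flexes a b c) = 4 * m" "forms_H_orbits (ordinary_flexes a b c) m 4"
    and "card (hyperflexes a b c) = 4 * h" "forms_H_orbits (hyperflexes a b c) h 4"
    and "m = 0 \<Longrightarrow> ordinary_flexes a b c = {}" "h = 0 \<Longrightarrow> hyperflexes a b c = {}"
proof -
  note types = count_simple_and_double_roots[OF degree_W root_order]
  have nz: "poly X t \<noteq> 0 \<and> poly Y t \<noteq> 0 \<and> poly Z t \<noteq> 0" if "order t W = 1 \<or> order t W = 2" for t
  proof -
    have "poly W t = 0" using that by (auto simp: order_root)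
    then show ?thesis by (rule root_off_axes)
  qed
  show "m + 2 * h = 6" using types(3) by (simp add: m_def h_def)
  show "card (ordinary_flexes a b c) = 4 * m" "forms_H_orbits (ordinary_flexes a b c) m 4"
    unfolding m_def
    by (rule sqrt_points_family[OF types(1) _ _ flexes_eq(1)[unfolded points_def]];
        use nz param_inj in simp)+
  show "card (hyperflexes a b c) = 4 * h" "forms_H_orbits (hyperflexes a b c) h 4"
    unfolding h_def
    by (rule sqrt_points_family[OF types(2) _ _ flexes_eq(2)[unfolded points_def]];
        use nz param_inj in simp)+
  show "ordinary_flexes a b c = {}" if "m = 0" using that types(1) flexes_eq(1) by (simp add: m_def)
  show "hyperflexes a b c = {}" if "h = 0" using that types(2) flexes_eq(2) by (simp add: h_def)
qed

end

theorem theorem3p10: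
  fixes a b c :: complex
  assumes "(a^2 - 1) * (b^2 - 1) * (c^2 - 1) * (a^2 - 4) * (b^2 - 4) * (c^2 - 4)
             * (a^2 + b^2 + c^2 - a*b*c - 4) \<noteq> 0"
    and "P1 a b c * P2 a b c * P3 a b c \<noteq> 0"
  shows "weierstrass1_points a b c = ordinary_flexes a b c \<union> hyperflexes a b c \<and>
    ((card (ordinary_flexes a b c) = 24 \<and> forms_H_orbits (ordinary_flexes a b c) 6 4 \<and>
      hyperflexes a b c = {}) \<or>
     (card (ordinary_flexes a b c) = 16 \<and> forms_H_orbits (ordinary_flexes a b c) 4 4 \<and>
      card (hyperflexes a b c) = 4 \<and> forms_H_orbits (hyperflexes a b c) 1 4) \<or>
     (card (ordinary_flexes a b c) = 8 \<and> forms_H_orbits (ordinary_flexes a b c) 2 4 \<and>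
      card (hyperflexes a b c) = 8 \<and> forms_H_orbits (hyperflexes a b c) 2 4) \<or>
     (ordinary_flexes a b c = {} \<and>
      card (hyperflexes a b c) = 12 \<and> forms_H_orbits (hyperflexes a b c) 3 4))"
proof -
  obtain w where w: "w^2 = c^2 - 4" using power2_csqrt by blast
  define r where "r = (w - c) / 2"
  have "r * 2 = w - c" by (simp add: r_def)
  with w have "4 * (r^2 + c*r + 1) = 0" by algebra
  then have "r^2 + c*r + 1 = 0" by (simp only: mult_eq_0_iff) simp
  then interpret bisquare_quartic a b c r
    using assms by unfold_locales simp_all
  define m h where "m = card {t. order t W = 1}" and "h = card {t. order t W = 2}"
  note orbits = flex_orbits[folded m_def h_def]
  have "h = 0 \<and> m = 6 \<or> h = 1 \<and> m = 4 \<or> h = 2 \<and> m = 2 \<or> h = 3 \<and> m = 0"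
    using orbits(1) by presburger
  then consider "h = 0" "m = 6" | "h = 1" "m = 4" | "h = 2" "m = 2" | "h = 3" "m = 0"
    by blast
  then show ?thesis
    using orbits flexes_eq(3) by cases simp_all
qed

end
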